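(* Let $d\ge1$, $a,c>0$, let $\mathbf{X}_0$ be an $\mathbb{R}^d$-valued random variable with law $P_{\mathbf{X}_0}\in\mathcal{P}_2(\mathbb{R}^d)$, let $\mathbf{K}(t)$ be a $d$-dimensional Kac process with parameters $(a,c)$ starting in $\mathbf{0}$, and let $\mathbf{X}_t:=\mathbf{X}_0+\mathbf{K}(t)$, $t\ge0$, be the Kac process starting in $\mathbf{X}_0$. Then, for the probability distribution flow $(\mu_t)_{t\ge0}:=(P_{\mathbf{X}_t})_{t\ge0}$ of the laws of $\mathbf{X}_t$, the following holds true: (i) $(\mu_t)_{t\ge0}$ is Lipschitz continuous in the Wasserstein space $(\mathcal{P}_2(\mathbb{R}^d),W_2)$ with constant $d^{1/2}c$, and $\mathbf{X}_t$ is almost surely Lipschitz continuous (in $t$) in $\mathbb{R}^d$ with the same constant. (ii) $(\mu_t)_{t\ge0}$ is an absolutely continuous curve in $AC^2([0,T];\mathcal{P}_2(\mathbb{R}^d))$ for any $T>0$, and admits a velocity field $v_t$ fulfilling $$\|v_t\|_{L_2(\mu_t)}^2\le d\,c^2\quad\text{for a.e. } t\in[0,\infty).$$ (iii) The support of $(\mu_t)_{t\ge0}$ grows at most linearly in time.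
   Context: $\mathcal{P}_2(\mathbb{R}^d)$ is the space of Borel probability measures on $\mathbb{R}^d$ with finite second moment, with the Wasserstein-2 distance $W_2$. For a bounded interval $I$, $AC^2(I;\mathcal{P}_2(\mathbb{R}^d))$ is the set of curves $\mu_t:I\to\mathcal{P}_2(\mathbb{R}^d)$ for which there is $m\in L_2(I)$ with $W_2(\mu_s,\mu_t)\le\int_s^tm(r)\,\mathrm{d}r$ for all $s\le t$ in $I$. A velocity field of $\mu_t$ is a Borel measurable vector field $v_t$ satisfying the continuity equation $\partial_t\mu_t+\nabla_x\cdot(\mu_tv_t)=0$ in the sense of distributions. $\|v_t\|_{L_2(\mu_t)}^2=\int\|v_t(x)\|^2\,\mathrm{d}\mu_t(x)$ with Euclidean norm. The one-dimensional Kac process starting in $0$ with parameters $a>0$ and $c>0$ is $K(t)=B\,c\int_0^t(-1)^{N(s)}\,\mathrm{d}s$, where $(N(s))_{s\ge0}$ is a homogeneous Poisson process with rate $a$ and $B$ is an independent random variable taking the values $\pm1$ with probability $\tfrac12$ each. A $d$-dimensional Kac process starting in $\mathbf{0}$ is $\mathbf{K}(t)=(K^1(t),\dots,K^d(t))$ with i.i.d. copies $K^i$ of such a process. *)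

theory Defs
  imports "HOL-Probability.Probability"
begin

section \<open>The Wasserstein space\<close>

definition P2 :: "'a::euclidean_space measure set" where
  "P2 = {\<mu>. prob_space \<mu> \<and> sets \<mu> = sets borel \<and> integrable \<mu> (\<lambda>x. (norm x)\<^sup>2)}"

definition couplings :: "'a::euclidean_space measure \<Rightarrow> 'a measure \<Rightarrow> ('a \<times> 'a) measure set" where
  "couplings \<mu> \<nu> =
     {\<gamma>. sets \<gamma> = sets (borel \<Otimes>\<^sub>M borel) \<and> distr \<gamma> borel fst = \<mu> \<and> distr \<gamma> borel snd = \<nu>}"

text \<open>On \<^const>\<open>P2\<close> the infimum is finite (the product measure is a coupling of finite cost), so
  \<^const>\<open>enn2real\<close> loses nothing there.\<close>

definition W2 :: "'a::euclidean_space measure \<Rightarrow> 'a measure \<Rightarrow> real" where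
  "W2 \<mu> \<nu> = sqrt (enn2real (INF \<gamma>\<in>couplings \<mu> \<nu>. \<integral>\<^sup>+ (x, y). ennreal ((dist x y)\<^sup>2) \<partial>\<gamma>))"

definition AC2 :: "real set \<Rightarrow> (real \<Rightarrow> 'a::euclidean_space measure) \<Rightarrow> bool" where
  "AC2 I \<mu> \<longleftrightarrow>
     (\<forall>t\<in>I. \<mu> t \<in> P2) \<and>
     (\<exists>m :: real \<Rightarrow> real.
        set_borel_measurable lborel I m \<and> set_integrable lborel I (\<lambda>r. (m r)\<^sup>2) \<and>
        (\<forall>s\<in>I. \<forall>t\<in>I. s \<le> t \<longrightarrow> W2 (\<mu> s) (\<mu> t) \<le> (LBINT r:{s..t}. m r)))"


section \<open>The continuity equation\<close>

primrec k_times_cont_diff :: "nat \<Rightarrow> ('a::euclidean_space \<Rightarrow> real) \<Rightarrow> bool" where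
  "k_times_cont_diff 0 f \<longleftrightarrow> continuous_on UNIV f"
| "k_times_cont_diff (Suc k) f \<longleftrightarrow>
     (\<forall>x. f differentiable (at x)) \<and>
     (\<forall>h. k_times_cont_diff k (\<lambda>x. frechet_derivative f (at x) h))"

text \<open>Functions in $C_c^\infty(J \times E)$, extended by zero to all of $\mathbb{R} \times E$.\<close>

definition test_function :: "real set \<Rightarrow> (real \<times> 'a::euclidean_space \<Rightarrow> real) \<Rightarrow> bool" where
  "test_function J \<phi> \<longleftrightarrow>
     (\<forall>k. k_times_cont_diff k \<phi>) \<and>
     compact (closure {z. \<phi> z \<noteq> 0}) \<and> closure {z. \<phi> z \<noteq> 0} \<subseteq> J \<times> UNIV"

text \<open>\<open>J\<close> is an open set of times. The equation
  $\partial_t\mu_t + \nabla_x\cdot(\mu_t v_t) = 0$ on \<open>J\<close> is tested against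
  $C_c^\infty(J \times E)$; the second summand of the integrand is
  $\langle\nabla_x\phi(t,x), v_t(x)\rangle$. The local integrability condition is what makes
  $\mu_t v_t$ a distribution; without it the integrals could hold vacuously, as Bochner integrals
  of non-integrable functions are 0. Outside \<open>J\<close> the values of \<open>v\<close> are irrelevant.\<close>

definition velocity_field ::
  "real set \<Rightarrow> (real \<Rightarrow> 'a::euclidean_space measure) \<Rightarrow> (real \<Rightarrow> 'a \<Rightarrow> 'a) \<Rightarrow> bool" where
  "velocity_field J \<mu> v \<longleftrightarrow>
     (\<lambda>(t, x). v t x) \<in> borel_measurable borel \<and>
     (\<forall>C. compact C \<and> C \<subseteq> J \<times> UNIV \<longrightarrow>
        (\<integral>\<^sup>+ t. (\<integral>\<^sup>+ x. indicator C (t, x) * ennreal (norm (v t x)) \<partial>\<mu> t) \<partial>lborel) < \<infinity>) \<and>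
     (\<forall>\<phi>. test_function J \<phi> \<longrightarrow>
        (let g = (\<lambda>t. \<integral>x. deriv (\<lambda>s. \<phi> (s, x)) t
                        + frechet_derivative (\<lambda>y. \<phi> (t, y)) (at x) (v t x) \<partial>\<mu> t)
         in set_integrable lborel J g \<and> (LBINT t:J. g t) = 0))"


section \<open>Kac processes\<close>

text \<open>Processes are indexed by real times; only times \<open>\<ge> 0\<close> matter. The truncated difference of
  naturals below is the true increment almost surely, since paths are almost surely monotone.\<close>

definition poisson_process :: "'w measure \<Rightarrow> real \<Rightarrow> (real \<Rightarrow> 'w \<Rightarrow> nat) \<Rightarrow> bool" where
  "poisson_process M a N \<longleftrightarrow>
     (\<forall>t\<ge>0. N t \<in> M \<rightarrow>\<^sub>M count_space UNIV) \<and>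
     (AE \<omega> in M. N 0 \<omega> = 0 \<and> mono_on {0..} (\<lambda>t. N t \<omega>) \<and>
        (\<forall>t\<ge>0. continuous (at_right t) (\<lambda>s. N s \<omega>))) \<and>
     (\<forall>n (t :: nat \<Rightarrow> real). 0 \<le> t 0 \<and> (\<forall>k<n. t k \<le> t (Suc k)) \<longrightarrow>
        prob_space.indep_vars M (\<lambda>_. count_space UNIV)
          (\<lambda>k \<omega>. N (t (Suc k)) \<omega> - N (t k) \<omega>) {..<n}) \<and>
     (\<forall>s t. 0 \<le> s \<and> s < t \<longrightarrow>
        distr M (count_space UNIV) (\<lambda>\<omega>. N t \<omega> - N s \<omega>) = measure_pmf (poisson_pmf (a * (t - s))))"

abbreviation path_space :: "(real \<Rightarrow> 'b::topological_space) measure" where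
  "path_space \<equiv> \<Pi>\<^sub>M t\<in>{0..}. borel"

abbreviation path :: "(real \<Rightarrow> 'w \<Rightarrow> 'b) \<Rightarrow> 'w \<Rightarrow> real \<Rightarrow> 'b" where
  "path Z \<omega> \<equiv> (\<lambda>t\<in>{0..}. Z t \<omega>)"

text \<open>One-dimensional Kac process starting in 0. The path formula is required almost surely,
  matching the almost sure path properties of the Poisson process; measurability of \<open>K t\<close> then has
  to be stated separately. Independence of \<open>B\<close> and \<open>N\<close> is that of the generated
  sigma-algebras (\<open>indep_var\<close> needs equal value types). On \<open>nat\<close>, the Borel sigma-algebra is the discrete one.\<close>

definition kac_process :: "'w measure \<Rightarrow> real \<Rightarrow> real \<Rightarrow> (real \<Rightarrow> 'w \<Rightarrow> real) \<Rightarrow> bool" where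
  "kac_process M a c K \<longleftrightarrow>
     (\<forall>t\<ge>0. K t \<in> borel_measurable M) \<and>
     (\<exists>N B. poisson_process M a N \<and>
        B \<in> borel_measurable M \<and>
        measure M {\<omega>\<in>space M. B \<omega> = 1} = 1 / 2 \<and> measure M {\<omega>\<in>space M. B \<omega> = - 1} = 1 / 2 \<and>
        prob_space.indep_set M (sets (vimage_algebra (space M) B borel))
          (sets (vimage_algebra (space M) (path N) path_space)) \<and>
        (AE \<omega> in M. \<forall>t\<ge>0. K t \<omega> = B \<omega> * c * (LBINT s:{0..t}. (- 1) ^ N s \<omega>)))"

text \<open>The components are i.i.d. as random elements of path space. Identical distribution already
  follows from the fact that the parameters agree.\<close>

definition kac_process_vec ::
  "'w measure \<Rightarrow> real \<Rightarrow> real \<Rightarrow> (real \<Rightarrow> 'w \<Rightarrow> real ^ 'n) \<Rightarrow> bool" where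
  "kac_process_vec M a c K \<longleftrightarrow>
     (\<forall>i. kac_process M a c (\<lambda>t \<omega>. K t \<omega> $ i)) \<and>
     prob_space.indep_vars M (\<lambda>_. path_space) (\<lambda>i. path (\<lambda>t \<omega>. K t \<omega> $ i)) UNIV \<and>
     (\<forall>i j. distr M path_space (path (\<lambda>t \<omega>. K t \<omega> $ i)) = distr M path_space (path (\<lambda>t \<omega>. K t \<omega> $ j)))"


section \<open>Supports\<close>

definition supp :: "'a::euclidean_space measure \<Rightarrow> 'a set" where
  "supp \<mu> = {x. \<forall>U. open U \<and> x \<in> U \<longrightarrow> emeasure \<mu> U > 0}"

definition support_grows_at_most_linearly :: "(real \<Rightarrow> 'a::euclidean_space measure) \<Rightarrow> bool" where
  "support_grows_at_most_linearly \<mu> \<longleftrightarrow>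
     (\<exists>C\<ge>0. \<forall>t\<ge>0. supp (\<mu> t) \<subseteq> (\<Union>x\<in>supp (\<mu> 0). cball x (C * t)))"

end

theory Submission
  imports Defs
begin

text \<open>Almost surely the paths of the Kac process are coordinatewise \<open>c\<close>-Lipschitz, and they have a
  right derivative at every time, because a right-continuous integer-valued \<open>N\<close> is constant on some
  $[t, t + \varepsilon)$. The law of \<open>(X s, X t)\<close> couples $\mu_s$ and $\mu_t$, so the Lipschitz bound
  passes to $W_2$, and to the supports. The velocity field is the conditional expectation
  $v_t(x) = E[V_t \mid X_t = x]$ of the right derivative $V$, a Radon--Nikodym density on space-time,
  and inherits the coordinatewise bound \<open>c\<close> from $V$. For a test function $\varphi$ the integral over
  time of $E[\varphi(t + h, X_{t+h}) - \varphi(t, X_t)]/h$ vanishes by translation invariance;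
  dominated convergence as $h \downarrow 0$ gives the continuity equation.\<close>

section \<open>Wasserstein distance and supports\<close>

text \<open>The paths have corners at random jump times. The right derivative still exists at every
  time, and it is the limit of one fixed sequence of difference quotients, so V is jointly
  measurable in time and \<omega>. Conditioning separately at each t would determine each v_t only
  up to a null set depending on t and leave its measurability in (t, x) open. A single density with
  respect to the image of Lebesgue measure times P under the map from (t, \<omega>) to (t,
  X_t(\<omega>)) settles both. All bounds stay coordinatewise as long as possible: conditioning
  preserves the bound c on each coordinate, and the factor sqrt d enters only when the d coordinates
  are combined into a Euclidean norm. Exceptional null sets and the boundary at time 0 are removed
  by passing to a modification defined for all real times; the time shift then leaves no boundary
  term.\<close>

lemma W2_le_of_coupling:
  fixes X Y :: "'w \<Rightarrow> 'a::euclidean_space"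
  assumes "prob_space M" and [measurable]: "X \<in> borel_measurable M" "Y \<in> borel_measurable M"
    and dist: "AE \<omega> in M. dist (X \<omega>) (Y \<omega>) \<le> r" and r: "0 \<le> r"
  shows "W2 (distr M borel X) (distr M borel Y) \<le> r"
proof -
  interpret prob_space M by fact
  let ?\<gamma> = "distr M (borel \<Otimes>\<^sub>M borel) (\<lambda>\<omega>. (X \<omega>, Y \<omega>))"
  have "?\<gamma> \<in> couplings (distr M borel X) (distr M borel Y)"
    by (simp add: couplings_def distr_distr comp_def)
  then have "(INF \<gamma>\<in>couplings (distr M borel X) (distr M borel Y). \<integral>\<^sup>+ (x, y). ennreal ((dist x y)\<^sup>2) \<partial>\<gamma>)
      \<le> (\<integral>\<^sup>+ (x, y). ennreal ((dist x y)\<^sup>2) \<partial>?\<gamma>)"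
    by (rule INF_lower)
  also have "\<dots> = (\<integral>\<^sup>+ \<omega>. ennreal ((dist (X \<omega>) (Y \<omega>))\<^sup>2) \<partial>M)"
    by (subst nn_integral_distr) auto
  also have "\<dots> \<le> (\<integral>\<^sup>+ \<omega>. ennreal (r\<^sup>2) \<partial>M)"
    using dist by (intro nn_integral_mono_AE) (auto intro!: ennreal_leI power_mono)
  also have "\<dots> = ennreal (r\<^sup>2)" by (simp add: emeasure_space_1)
  finally have "W2 (distr M borel X) (distr M borel Y) \<le> sqrt (r\<^sup>2)"
    unfolding W2_def by (intro real_sqrt_le_mono enn2real_leI) auto
  with r show ?thesis by simp
qed

lemma closed_supp: "closed (supp \<mu>)"
proof -
  have "- supp \<mu> = \<Union>{U. open U \<and> emeasure \<mu> U = 0}"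
    by (auto simp: supp_def)
  then show ?thesis by (auto simp: closed_def)
qed

text \<open>The complement of the support is a union of possibly uncountably many open null sets.
  The Lindelof property leaves countably many of them.\<close>

lemma emeasure_Compl_supp:
  fixes \<mu> :: "'a::euclidean_space measure"
  assumes sets: "sets \<mu> = sets borel"
  shows "emeasure \<mu> (- supp \<mu>) = 0"
proof -
  let ?F = "{U. open U \<and> emeasure \<mu> U = 0}"
  obtain G where G: "G \<subseteq> ?F" "countable G" "\<Union>G = \<Union>?F"
    using Lindelof[of ?F] by auto
  have "\<Union>G \<in> null_sets \<mu>"
    using G(1,2) by (intro null_sets_UN'[of G "\<lambda>x. x", simplified]) (auto simp: null_sets_def sets)
  moreover have "- supp \<mu> = \<Union>?F" by (auto simp: supp_def)
  ultimately show ?thesis using G(3) by (auto simp: null_sets_def)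
qed

text \<open>Since \<open>X\<close> lies in its closed support almost surely, a point
  \<open>y\<close> farther than \<open>r + e\<close> from that support has a ball of radius
  \<open>e\<close> that \<open>Y\<close> almost surely avoids. Closedness provides a nearest point,
  which allows \<open>e\<close> to tend to 0.\<close>

lemma supp_subset_of_dist_le:
  fixes X Y :: "'w \<Rightarrow> 'a::euclidean_space"
  assumes [measurable]: "X \<in> borel_measurable M" "Y \<in> borel_measurable M"
    and dist: "AE \<omega> in M. dist (X \<omega>) (Y \<omega>) \<le> r"
  shows "supp (distr M borel Y) \<subseteq> (\<Union>x\<in>supp (distr M borel X). cball x r)"
proof
  fix y assume y: "y \<in> supp (distr M borel Y)"
  let ?S = "supp (distr M borel X)"
  have [measurable]: "?S \<in> sets borel" by (intro borel_closed closed_supp)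
  have near: "\<exists>x\<in>?S. dist y x \<le> r + e" if "e > 0" for e
  proof (rule ccontr)
    assume far: "\<not> (\<exists>x\<in>?S. dist y x \<le> r + e)"
    have "emeasure (distr M borel X) (- ?S) = 0" by (rule emeasure_Compl_supp) simp
    then have "AE x in distr M borel X. x \<notin> - ?S" by (intro AE_not_in) (auto simp: null_sets_def)
    then have "AE \<omega> in M. X \<omega> \<in> ?S" by (subst (asm) AE_distr_iff) auto
    with dist have "AE \<omega> in M. Y \<omega> \<notin> ball y e"
    proof eventually_elim
      case (elim \<omega>)
      then have "r + e < dist y (X \<omega>)" using far by force
      then show ?case using elim dist_triangle[of y "X \<omega>" "Y \<omega>"] by (auto simp: dist_commute)
    qed
    then have "AE x in distr M borel Y. x \<notin> ball y e" by (subst AE_distr_iff) auto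
    then have "emeasure (distr M borel Y) (ball y e) = 0"
      by (subst (asm) AE_iff_measurable[of "ball y e"]) auto
    moreover have "emeasure (distr M borel Y) (ball y e) > 0"
      using y that unfolding supp_def by auto
    ultimately show False by simp
  qed
  \<comment> \<open>The value 1 is arbitrary: only nonemptiness of \<open>?S\<close> is wanted, so
    that the distance to it is attained.\<close>
  obtain x0 where "x0 \<in> ?S" using near[of 1] by auto
  then have "?S \<noteq> {}" by auto
  then obtain x where x: "x \<in> ?S" "\<And>z. z \<in> ?S \<Longrightarrow> dist y x \<le> dist y z"
    using distance_attains_inf[OF closed_supp, of "distr M borel X" y] by blast
  have "dist y x \<le> r"
  proof (rule field_le_epsilon)
    fix e :: real assume "e > 0"
    then show "dist y x \<le> r + e" using near[of e] x(2) by force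
  qed
  with x(1) show "y \<in> (\<Union>x\<in>?S. cball x r)" by (auto simp: dist_commute)
qed

lemma Lipschitz_curve_AC2:
  assumes P2: "\<And>t. 0 \<le> t \<Longrightarrow> \<mu> t \<in> P2"
    and Lip: "\<And>s t. 0 \<le> s \<Longrightarrow> 0 \<le> t \<Longrightarrow> W2 (\<mu> s) (\<mu> t) \<le> L * \<bar>s - t\<bar>"
  shows "AC2 {0..T} \<mu>"
  unfolding AC2_def
proof (intro conjI exI[of _ "\<lambda>_. L"] ballI impI)
  show "set_borel_measurable lborel {0..T} (\<lambda>_. L)"
    by (simp add: set_borel_measurable_def)
  show "set_integrable lborel {0..T} (\<lambda>_. L\<^sup>2)"
    by (rule borel_integrable_atLeastAtMost') auto
  fix s t assume "s \<in> {0..T}" "t \<in> {0..T}" "s \<le> t"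
  then show "W2 (\<mu> s) (\<mu> t) \<le> (LBINT r:{s..t}. L)"
    using Lip[of s t] by (simp add: set_lebesgue_integral_def mult.commute)
qed (use P2 in auto)

section \<open>Paths of the Kac process\<close>

lemma alternating_primitive:
  fixes n :: "real \<Rightarrow> nat"
  assumes mono: "mono_on {0..} n" and cont: "\<And>t. 0 \<le> t \<Longrightarrow> continuous (at_right t) n"
  defines "I \<equiv> \<lambda>t. LBINT s:{0..t}. (- 1 :: real) ^ n s"
  shows alternating_primitive_lipschitz: "0 \<le> s \<Longrightarrow> 0 \<le> t \<Longrightarrow> \<bar>I t - I s\<bar> \<le> \<bar>t - s\<bar>"
    and alternating_primitive_right_derivative:
      "0 \<le> t \<Longrightarrow> (I has_vector_derivative (- 1) ^ n t) (at t within {t..})"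
proof -
  \<comment> \<open>Nothing is known about \<open>n\<close> at negative times. Freezing it there
    makes it monotone on the whole line, and monotonicity yields Borel measurability.\<close>
  define f :: "real \<Rightarrow> real" where "f s = (- 1) ^ n (max s 0)" for s
  have "mono (\<lambda>s. real (n (max s 0)))"
  proof (rule monoI)
    fix x y :: real assume "x \<le> y"
    then show "real (n (max x 0)) \<le> real (n (max y 0))"
      using mono_onD[OF mono, of "max x 0" "max y 0"] by simp
  qed
  then have [measurable]: "(\<lambda>s. real (n (max s 0))) \<in> borel_measurable borel"
    by (rule borel_measurable_mono)
  \<comment> \<open>Rounding the real-valued function carries its measurability back to the discrete
    space of naturals.\<close>
  have "(\<lambda>s. nat \<lfloor>real (n (max s 0))\<rfloor>) \<in> borel \<rightarrow>\<^sub>M count_space UNIV"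
    by measurable
  then have [measurable]: "(\<lambda>s. n (max s 0)) \<in> borel \<rightarrow>\<^sub>M count_space UNIV" by simp
  have [measurable]: "f \<in> borel_measurable borel"
    unfolding f_def by measurable
  have f1: "\<bar>f s\<bar> = 1" for s by (simp add: f_def power_abs)
  have int: "set_integrable lborel {s..t} f" for s t
    unfolding set_integrable_def
    by (rule integrableI_bounded_set_indicator[where B=1]) (auto simp: f1 emeasure_lborel_Icc_eq)
  have I: "I t = (LBINT s:{0..t}. f s)" for t
    unfolding I_def by (rule set_lebesgue_integral_cong) (auto simp: f_def)
  have diff: "I t - I s = (LBINT u:{s<..t}. f u)" if "0 \<le> s" "s \<le> t" for s t
  proof -
    have "{0..t} = {0..s} \<union> {s<..t}" using that by auto
    then have "I t = I s + (LBINT u:{s<..t}. f u)"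
      unfolding I using that
      by (simp only:) (rule set_integral_Un; auto intro: set_integrable_subset[OF int[of s t]] int)
    then show ?thesis by simp
  qed
  have le: "\<bar>I t - I s\<bar> \<le> t - s" if "0 \<le> s" "s \<le> t" for s t
  proof -
    have i: "set_integrable lborel {s<..t} f"
      by (rule set_integrable_subset[OF int[of s t]]) auto
    have "\<bar>LBINT u:{s<..t}. f u\<bar> \<le> (LBINT u:{s<..t}. \<bar>f u\<bar>)"
      using set_integral_norm_bound[OF i] by simp
    also have "\<dots> = t - s" using that by (simp add: f1 set_lebesgue_integral_def)
    finally show ?thesis using diff[OF that] by simp
  qed
  show "\<bar>I t - I s\<bar> \<le> \<bar>t - s\<bar>" if "0 \<le> s" "0 \<le> t" for s t
    using le[of s t] le[of t s] that by (cases "s \<le> t") auto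
  show "(I has_vector_derivative (- 1) ^ n t) (at t within {t..})" if t: "0 \<le> t" for t
  proof -
    have "(n \<longlongrightarrow> n t) (at_right t)" using cont[OF t] by (simp add: continuous_within)
    \<comment> \<open>Right continuity supplies the upper bound and monotonicity the lower one, so
      \<open>n\<close> equals \<open>n t\<close> just after \<open>t\<close> and \<open>I\<close> is
      affine there.\<close>
    then have "\<forall>\<^sub>F s in at_right t. n s < Suc (n t)"
      by (rule order_tendstoD) simp
    then obtain b where b: "t < b" "\<And>s. t < s \<Longrightarrow> s < b \<Longrightarrow> n s < Suc (n t)"
      unfolding eventually_at_right_field by blast
    have const: "n s = n t" if "t < s" "s < b" for s
      using b(2)[OF that] mono_onD[OF mono, of t s] t that by simp
    have eq: "I s = I t + (s - t) * (- 1) ^ n t" if "t \<le> s" "s < b" for s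
    proof -
      have "(LBINT u:{t<..s}. f u) = (LBINT u:{t<..s}. (- 1) ^ n t)"
        by (rule set_lebesgue_integral_cong) (use const t that in \<open>auto simp: f_def\<close>)
      then show ?thesis using diff[of t s] that t by (simp add: set_lebesgue_integral_def)
    qed
    have "((\<lambda>s. I t + (s - t) * (- 1) ^ n t) has_vector_derivative (- 1) ^ n t) (at t within {t..})"
      unfolding has_real_derivative_iff_has_vector_derivative[symmetric]
      by (auto intro!: derivative_eq_intros)
    then show ?thesis
    proof (rule has_vector_derivative_transform_within[where d = "b - t"])
      show "I t + (s - t) * (- 1) ^ n t = I s" if "s \<in> {t..}" "dist s t < b - t" for s
        using eq[of s] that by (auto simp: dist_real_def)
    qed (use b in auto)
  qed
qed

lemma kac_process_paths:
  assumes M: "prob_space M" and c: "0 \<le> c" and K: "kac_process M a c K"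
  shows "AE \<omega> in M. K 0 \<omega> = 0 \<and> (\<forall>s\<ge>0. \<forall>t\<ge>0. \<bar>K t \<omega> - K s \<omega>\<bar> \<le> c * \<bar>t - s\<bar>)
    \<and> (\<forall>t\<ge>0. \<exists>D. ((\<lambda>s. K s \<omega>) has_vector_derivative D) (at t within {t..}))"
proof -
  interpret prob_space M by (rule M)
  obtain N B where N: "poisson_process M a N" and [measurable]: "B \<in> borel_measurable M"
    and B: "prob {\<omega>\<in>space M. B \<omega> = 1} = 1 / 2" "prob {\<omega>\<in>space M. B \<omega> = - 1} = 1 / 2"
    and path: "AE \<omega> in M. \<forall>t\<ge>0. K t \<omega> = B \<omega> * c * (LBINT s:{0..t}. (- 1) ^ N s \<omega>)"
    using K unfolding kac_process_def by blast
  \<comment> \<open>Two disjoint events of mass 1/2 exhaust the space, so the factor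
    \<open>B\<close> has modulus 1 almost surely and leaves the Lipschitz constant
    unchanged.\<close>
  have "prob ({\<omega>\<in>space M. B \<omega> = 1} \<union> {\<omega>\<in>space M. B \<omega> = - 1}) = 1"
    by (subst finite_measure_Union) (auto simp: B)
  then have "AE \<omega> in M. \<omega> \<in> {\<omega>\<in>space M. B \<omega> = 1} \<union> {\<omega>\<in>space M. B \<omega> = - 1}"
    by (subst (asm) prob_eq_1) auto
  then have B1: "AE \<omega> in M. \<bar>B \<omega>\<bar> = 1" by eventually_elim auto
  have "AE \<omega> in M. mono_on {0..} (\<lambda>t. N t \<omega>) \<and> (\<forall>t\<ge>0. continuous (at_right t) (\<lambda>s. N s \<omega>))"
    using N unfolding poisson_process_def AE_conj_iff by blast
  with B1 path show ?thesis
  proof eventually_elim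
    case (elim \<omega>)
    define I where "I t = (LBINT s:{0..t}. (- 1 :: real) ^ N s \<omega>)" for t
    have K: "K t \<omega> = B \<omega> * c * I t" if "0 \<le> t" for t using elim(2) that by (simp add: I_def)
    have lip: "\<bar>I t - I s\<bar> \<le> \<bar>t - s\<bar>" if "0 \<le> s" "0 \<le> t" for s t
      unfolding I_def using elim(3) that by (intro alternating_primitive_lipschitz) auto
    have der: "(I has_vector_derivative (- 1) ^ N t \<omega>) (at t within {t..})" if "0 \<le> t" for t
      unfolding I_def using elim(3) that by (intro alternating_primitive_right_derivative) auto
    have "AE u in lborel. indicator {0..0::real} u *\<^sub>R (- 1 :: real) ^ N u \<omega> = 0"
      using AE_lborel_singleton[of "0::real"] by eventually_elim auto
    then have "I 0 = 0"
      unfolding I_def set_lebesgue_integral_def by (rule integral_eq_zero_AE)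
    then have "K 0 \<omega> = 0" using K[of 0] by simp
    moreover have "\<bar>K t \<omega> - K s \<omega>\<bar> \<le> c * \<bar>t - s\<bar>" if "0 \<le> s" "0 \<le> t" for s t
    proof -
      have "\<bar>K t \<omega> - K s \<omega>\<bar> = \<bar>B \<omega>\<bar> * c * \<bar>I t - I s\<bar>"
        using c that by (simp add: K right_diff_distrib[symmetric] abs_mult)
      then show ?thesis using elim(1) lip[OF that] c by (simp add: mult_left_mono)
    qed
    moreover have "\<exists>D. ((\<lambda>s. K s \<omega>) has_vector_derivative D) (at t within {t..})" if t: "0 \<le> t" for t
    proof
      show "((\<lambda>s. K s \<omega>) has_vector_derivative B \<omega> * c * (- 1) ^ N t \<omega>) (at t within {t..})"
        by (rule has_vector_derivative_transform[OF _ _ has_vector_derivative_mult_right[OF der[OF t]]])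
           (use t in \<open>auto simp: K\<close>)
    qed
    ultimately show ?case by blast
  qed
qed

section \<open>Conditional densities and test functions\<close>

text \<open>The composite of \<open>f\<close> with \<open>\<Phi>\<close> is the conditional
  expectation of \<open>g\<close> given \<open>\<Phi>\<close>, for a measure that may be infinite.
  Because \<open>g\<close> is signed, Radon-Nikodym is applied to \<open>c + g\<close>, which lies
  between 0 and \<open>2 * c\<close>, and \<open>c\<close> is subtracted afterwards. Working on the
  image space makes the result a function of \<open>\<Phi>\<close> from the outset.\<close>

lemma bounded_density_of_image:
  fixes g :: "'b \<Rightarrow> real"
  assumes D: "sigma_finite_measure (distr M N \<Phi>)" and \<Phi>[measurable]: "\<Phi> \<in> M \<rightarrow>\<^sub>M N"
    and g[measurable]: "g \<in> borel_measurable M"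
    and bound: "\<And>x. x \<in> space M \<Longrightarrow> \<bar>g x\<bar> \<le> c" and c: "0 \<le> c"
  obtains f where "f \<in> borel_measurable N" "\<And>y. \<bar>f y\<bar> \<le> c"
    "\<And>\<psi>. \<psi> \<in> borel_measurable N \<Longrightarrow> integrable M (\<lambda>x. \<psi> (\<Phi> x)) \<Longrightarrow>
       (\<integral>x. \<psi> (\<Phi> x) * g x \<partial>M) = (\<integral>x. \<psi> (\<Phi> x) * f (\<Phi> x) \<partial>M)"
proof -
  let ?D = "distr M N \<Phi>"
  interpret D: sigma_finite_measure ?D by (rule D)
  \<comment> \<open>\<open>ennreal\<close> would cut off negative values of \<open>h\<close>; the
    two densities used, \<open>c + g\<close> and \<open>c - g\<close>, are nonnegative on the
    space.\<close>
  define R where "R h = distr (density M (\<lambda>x. ennreal (h x))) N \<Phi>" for h :: "'b \<Rightarrow> real"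
  have R: "emeasure (R h) A = (\<integral>\<^sup>+x. ennreal (h x) * indicator A (\<Phi> x) \<partial>M)"
    if A[measurable]: "A \<in> sets N" and [measurable]: "h \<in> borel_measurable M" for A h
  proof -
    have "indicator (\<Phi> -` A \<inter> space M) x = (indicator A (\<Phi> x) :: ennreal)" if "x \<in> space M" for x
      using that by (auto simp: indicator_def)
    then show ?thesis
      unfolding R_def
      by (subst emeasure_distr; simp; subst emeasure_density; auto intro!: nn_integral_cong)
  qed
  have ex: "\<exists>k\<in>borel_measurable ?D. density ?D k = R h" if [measurable]: "h \<in> borel_measurable M" for h
  proof (rule D.Radon_Nikodym)
    show "absolutely_continuous ?D (R h)"
      unfolding absolutely_continuous_def
    proof
      fix A assume "A \<in> null_sets ?D"
      then have A[measurable]: "A \<in> sets N" and "AE y in ?D. y \<notin> A" by (auto intro: AE_not_in)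
      then have "AE x in M. \<Phi> x \<notin> A" by (subst (asm) AE_distr_iff) auto
      then have "emeasure (R h) A = 0"
        by (auto simp: R nn_integral_0_iff_AE)
      then show "A \<in> null_sets (R h)" by (auto simp: null_sets_def R_def)
    qed
  qed (simp add: R_def)
  \<comment> \<open>The density \<open>l\<close> for \<open>c - g\<close> only serves to bound \<open>k\<close>, as \<open>k + l = 2 * c\<close> almost everywhere.\<close>
  obtain k l where kl[measurable]: "k \<in> borel_measurable ?D" "l \<in> borel_measurable ?D"
    and k: "density ?D k = R (\<lambda>x. c + g x)" and l: "density ?D l = R (\<lambda>x. c - g x)"
    using ex[of "\<lambda>x. c + g x"] ex[of "\<lambda>x. c - g x"] by auto
  have [measurable]: "k \<in> borel_measurable N" using kl(1) by simp
  have sum_eq: "density ?D (\<lambda>y. k y + l y) = density ?D (\<lambda>y. ennreal (2 * c))"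
  proof (rule measure_eqI)
    fix A assume "A \<in> sets (density ?D (\<lambda>y. k y + l y))"
    then have A[measurable]: "A \<in> sets N" by simp
    have "emeasure (density ?D (\<lambda>y. k y + l y)) A = emeasure (density ?D k) A + emeasure (density ?D l) A"
      by (simp add: emeasure_density distrib_right nn_integral_add del: nn_integral_distr)
    also have "\<dots> = (\<integral>\<^sup>+x. ennreal (c + g x) * indicator A (\<Phi> x) + ennreal (c - g x) * indicator A (\<Phi> x) \<partial>M)"
      unfolding k l by (simp add: R nn_integral_add)
    also have "\<dots> = (\<integral>\<^sup>+x. ennreal (2 * c) * indicator A (\<Phi> x) \<partial>M)"
    proof (rule nn_integral_cong)
      fix x assume "x \<in> space M"
      from bound[OF this] have "ennreal (c + g x) + ennreal (c - g x) = ennreal (2 * c)"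
        by (subst ennreal_plus[symmetric]) auto
      then show "ennreal (c + g x) * indicator A (\<Phi> x) + ennreal (c - g x) * indicator A (\<Phi> x)
          = ennreal (2 * c) * indicator A (\<Phi> x)"
        by (simp add: distrib_right[symmetric])
    qed
    also have "\<dots> = emeasure (density ?D (\<lambda>y. ennreal (2 * c))) A"
      by (simp add: emeasure_density nn_integral_distr)
    finally show "emeasure (density ?D (\<lambda>y. k y + l y)) A = emeasure (density ?D (\<lambda>y. ennreal (2 * c))) A" .
  qed simp
  have "AE y in ?D. k y + l y = ennreal (2 * c)"
    by (rule D.density_unique[OF _ _ sum_eq]) auto
  then have AE_le: "AE y in ?D. k y \<le> ennreal (2 * c)"
    by eventually_elim (metis le_iff_add)
  \<comment> \<open>Truncation turns the almost everywhere bound on \<open>k\<close> into one at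
    every point, without changing the measure that it defines.\<close>
  define m where "m y = min (2 * c) (enn2real (k y))" for y
  have [measurable]: "m \<in> borel_measurable N" unfolding m_def by measurable
  have m: "0 \<le> m y" "m y \<le> 2 * c" for y using c by (auto simp: m_def)
  have "AE y in ?D. k y = ennreal (m y)"
    using AE_le
  proof eventually_elim
    case (elim y)
    with c have "k y = ennreal (enn2real (k y))" "enn2real (k y) \<le> 2 * c"
      by (auto simp: enn2real_leI ennreal_enn2real_if top_unique)
    then show ?case by (simp add: m_def)
  qed
  then have dens: "density ?D (\<lambda>y. ennreal (m y)) = R (\<lambda>x. c + g x)"
    unfolding k[symmetric] by (intro density_cong) auto
  show thesis
  proof (rule that[of "\<lambda>y. m y - c"])
    show mc: "\<bar>m y - c\<bar> \<le> c" for y using m[of y] by auto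
    fix \<psi> :: "'a \<Rightarrow> real" assume [measurable]: "\<psi> \<in> borel_measurable N" and int: "integrable M (\<lambda>x. \<psi> (\<Phi> x))"
    \<comment> \<open>Needed at the end, where the common term with the factor \<open>c\<close> is
      split off both integrals and cancelled.\<close>
    have bnd: "integrable M (\<lambda>x. \<psi> (\<Phi> x) * u x)"
      if "u \<in> borel_measurable M" "\<And>x. x \<in> space M \<Longrightarrow> \<bar>u x\<bar> \<le> c" for u
      using integrable_bounded_linear[OF bounded_linear_mult_left[of c] int] that c
      by (elim Bochner_Integration.integrable_bound)
         (auto intro!: AE_I2 simp: abs_mult mult_left_mono)
    have "(\<integral>x. \<psi> (\<Phi> x) * (c + g x) \<partial>M) = (\<integral>x. (c + g x) * \<psi> (\<Phi> x) \<partial>M)"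
      by (simp add: mult.commute)
    also have "\<dots> = (\<integral>x. \<psi> (\<Phi> x) \<partial>density M (\<lambda>x. ennreal (c + g x)))"
      by (intro integral_real_density[symmetric] AE_I2) (auto dest!: bound)
    also have "\<dots> = (\<integral>y. \<psi> y \<partial>R (\<lambda>x. c + g x))"
      unfolding R_def by (intro integral_distr[symmetric]) auto
    also have "\<dots> = (\<integral>y. m y * \<psi> y \<partial>?D)"
      unfolding dens[symmetric] by (intro integral_real_density AE_I2) (auto simp: m)
    also have "\<dots> = (\<integral>x. \<psi> (\<Phi> x) * m (\<Phi> x) \<partial>M)"
      by (simp add: integral_distr mult.commute)
    finally have "(\<integral>x. \<psi> (\<Phi> x) * c + \<psi> (\<Phi> x) * g x \<partial>M) = (\<integral>x. \<psi> (\<Phi> x) * c + \<psi> (\<Phi> x) * (m (\<Phi> x) - c) \<partial>M)"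
      by (simp add: algebra_simps)
    then show "(\<integral>x. \<psi> (\<Phi> x) * g x \<partial>M) = (\<integral>x. \<psi> (\<Phi> x) * (m (\<Phi> x) - c) \<partial>M)"
      using bnd[of "\<lambda>x. m (\<Phi> x) - c"] bnd[OF g bound] mc int
      by (subst (asm) (1 2) Bochner_Integration.integral_add) auto
  qed simp
qed

text \<open>Rounding \<open>t\<close> down to a multiple of \<open>1 / (n + 1)\<close> leaves
  countably many sampling times, so each approximation is jointly measurable; path continuity gives
  convergence.\<close>

lemma borel_measurable_continuous_process:
  fixes Y :: "real \<Rightarrow> 'w \<Rightarrow> 'a::{real_normed_vector, second_countable_topology}"
  assumes Y: "\<And>t. Y t \<in> borel_measurable M"
    and cont: "\<And>\<omega>. \<omega> \<in> space M \<Longrightarrow> continuous_on UNIV (\<lambda>t. Y t \<omega>)"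
  shows "(\<lambda>(t, \<omega>). Y t \<omega>) \<in> borel_measurable (borel \<Otimes>\<^sub>M M)"
proof (rule borel_measurable_LIMSEQ_metric)
  let ?q = "\<lambda>n t :: real. of_int \<lfloor>t * real (Suc n)\<rfloor> / real (Suc n)"
  show "(\<lambda>(t, \<omega>). Y (?q n t) \<omega>) \<in> borel_measurable (borel \<Otimes>\<^sub>M M)" for n
  proof -
    have "(\<lambda>z. Y (of_int k / real (Suc n)) (snd z)) \<in> borel_measurable (borel \<Otimes>\<^sub>M M)" for k
      using Y by measurable
    then have "(\<lambda>z. (\<lambda>k z. Y (of_int k / real (Suc n)) (snd z)) \<lfloor>fst z * real (Suc n)\<rfloor> z) \<in> borel_measurable (borel \<Otimes>\<^sub>M M)"
      by (rule measurable_compose_countable) measurable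
    then show ?thesis by (simp add: case_prod_beta)
  qed
  fix z :: "real \<times> 'w" assume "z \<in> space (borel \<Otimes>\<^sub>M M)"
  then obtain t \<omega> where z: "z = (t, \<omega>)" and \<omega>: "\<omega> \<in> space M"
    by (auto simp: space_pair_measure)
  have "(\<lambda>n. ?q n t) \<longlonglongrightarrow> t"
  proof (rule tendsto_sandwich)
    show "\<forall>\<^sub>F n in sequentially. t - inverse (real (Suc n)) \<le> ?q n t"
    proof (rule always_eventually, rule allI)
      fix n
      have "t * real (Suc n) - 1 \<le> of_int \<lfloor>t * real (Suc n)\<rfloor>" by linarith
      then have "(t * real (Suc n) - 1) / real (Suc n) \<le> ?q n t" by (intro divide_right_mono) auto
      then show "t - inverse (real (Suc n)) \<le> ?q n t" by (simp add: diff_divide_distrib inverse_eq_divide)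
    qed
    show "\<forall>\<^sub>F n in sequentially. ?q n t \<le> t"
    proof (rule always_eventually, rule allI)
      fix n
      have "of_int \<lfloor>t * real (Suc n)\<rfloor> \<le> t * real (Suc n)" by linarith
      then show "?q n t \<le> t" by (simp add: pos_divide_le_eq del: of_nat_Suc)
    qed
    show "(\<lambda>n. t - inverse (real (Suc n))) \<longlonglongrightarrow> t"
      using tendsto_diff[OF tendsto_const LIMSEQ_inverse_real_of_nat, of t] by simp
  qed simp
  then have "(\<lambda>n. Y (?q n t) \<omega>) \<longlonglongrightarrow> Y t \<omega>"
    using cont[OF \<omega>] by (auto intro: continuous_on_tendsto_compose)
  then show "(\<lambda>n. case z of (t, \<omega>) \<Rightarrow> Y (?q n t) \<omega>) \<longlonglongrightarrow> (case z of (t, \<omega>) \<Rightarrow> Y t \<omega>)"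
    by (simp add: z)
qed

section \<open>Calculus of space-time test functions\<close>

lemma test_function_differentiable:
  "test_function J \<phi> \<Longrightarrow> \<phi> differentiable (at z)"
  unfolding test_function_def using k_times_cont_diff.simps(2)[of 0 \<phi>] by blast

lemma test_function_continuous_derivative:
  assumes "test_function J \<phi>"
  shows "continuous_on UNIV (\<lambda>z. frechet_derivative \<phi> (at z) h)"
proof -
  have "k_times_cont_diff (Suc 0) \<phi>" using assms unfolding test_function_def by blast
  then show ?thesis by (cases h) simp
qed

lemma test_function_has_derivative:
  "test_function J \<phi> \<Longrightarrow> (\<phi> has_derivative frechet_derivative \<phi> (at z)) (at z)"
  using test_function_differentiable frechet_derivative_works by blast

lemma test_function_derivative_eq_0:
  assumes \<phi>: "test_function J \<phi>" and z: "z \<notin> closure {z. \<phi> z \<noteq> 0}"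
  shows "frechet_derivative \<phi> (at z) = (\<lambda>h. 0)"
proof -
  have "(\<phi> has_derivative (\<lambda>h. 0)) (at z)"
    by (rule has_derivative_transform_within_open[of "\<lambda>_. 0" _ _ _ "- closure {z. \<phi> z \<noteq> 0}"])
       (use z closure_subset[of "{z. \<phi> z \<noteq> 0}"] in auto)
  then show ?thesis by (rule frechet_derivative_at[symmetric])
qed

text \<open>This turns the integrand of the continuity equation into one total derivative in
  direction \<open>(1, w)\<close>, the form in which the chain rule along the space-time path
  \<open>(s, Y s)\<close> produces it.\<close>

lemma test_function_split_derivative:
  assumes "test_function J \<phi>"
  shows "deriv (\<lambda>s. \<phi> (s, x)) t + frechet_derivative (\<lambda>y. \<phi> (t, y)) (at x) w
    = frechet_derivative \<phi> (at (t, x)) (1, w)"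
proof -
  let ?D = "frechet_derivative \<phi> (at (t, x))"
  have D: "(\<phi> has_derivative ?D) (at (t, x))"
    by (rule test_function_has_derivative[OF assms])
  then have lin: "linear ?D" by (rule has_derivative_linear)
  have "((\<lambda>s. \<phi> (s, x)) has_derivative (\<lambda>h. ?D (h, 0))) (at t)"
    using diff_chain_at[OF has_derivative_Pair[OF has_derivative_ident has_derivative_const] D]
    by (simp only: comp_def)
  moreover have "(\<lambda>h. ?D (h, 0)) = (*) (?D (1, 0))"
  proof
    show "?D (h, 0) = ?D (1, 0) * h" for h
      using linear_scale[OF lin, of h "(1, 0)"] by (simp add: mult.commute)
  qed
  ultimately have "((\<lambda>s. \<phi> (s, x)) has_field_derivative ?D (1, 0)) (at t)"
    by (simp only: has_field_derivative_def)
  then have 1: "deriv (\<lambda>s. \<phi> (s, x)) t = ?D (1, 0)" by (rule DERIV_imp_deriv)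
  have "((\<lambda>y. \<phi> (t, y)) has_derivative (\<lambda>h. ?D (0, h))) (at x)"
    using diff_chain_at[OF has_derivative_Pair[OF has_derivative_const has_derivative_ident] D]
    by (simp only: comp_def)
  then have 2: "frechet_derivative (\<lambda>y. \<phi> (t, y)) (at x) = (\<lambda>h. ?D (0, h))"
    by (rule frechet_derivative_at[symmetric])
  show ?thesis unfolding 1 2 using linear_add[OF lin, of "(1, 0)" "(0, w)"] by simp
qed

lemma test_function_directional_bounded:
  assumes \<phi>: "test_function J \<phi>"
  shows "\<exists>B. \<forall>z. \<bar>frechet_derivative \<phi> (at z) h\<bar> \<le> B"
proof -
  let ?S = "closure {z. \<phi> z \<noteq> 0}"
  have "compact ((\<lambda>z. frechet_derivative \<phi> (at z) h) ` ?S)"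
    using \<phi> unfolding test_function_def
    by (intro compact_continuous_image continuous_on_subset[OF test_function_continuous_derivative[OF \<phi>]]) auto
  then obtain B where B: "\<forall>z\<in>?S. \<bar>frechet_derivative \<phi> (at z) h\<bar> \<le> B"
    unfolding real_norm_def[symmetric] by (meson bounded_iff compact_imp_bounded imageI)
  have "\<bar>frechet_derivative \<phi> (at z) h\<bar> \<le> max B 0" for z
    using B test_function_derivative_eq_0[OF \<phi>, of z] by (cases "z \<in> ?S") auto
  then show ?thesis by blast
qed

text \<open>Each basis direction has a bound uniform in \<open>z\<close> by continuity and compact
  support; by linearity the finitely many bounds add up to one on the operator norm.\<close>

lemma test_function_derivative_bounded:
  assumes \<phi>: "test_function J (\<phi> :: real \<times> 'a::euclidean_space \<Rightarrow> real)"
  obtains L where "0 \<le> L" "\<And>z h. \<bar>frechet_derivative \<phi> (at z) h\<bar> \<le> L * norm h"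
proof -
  have "\<forall>b. \<exists>B. \<forall>z. \<bar>frechet_derivative \<phi> (at z) b\<bar> \<le> B"
    using test_function_directional_bounded[OF \<phi>] by blast
  from choice[OF this] obtain B where B: "\<And>b z. \<bar>frechet_derivative \<phi> (at z) b\<bar> \<le> B b"
    by blast
  have B0: "0 \<le> B b" for b using B[of "(0,0)" b] by linarith
  let ?L = "\<Sum>b\<in>Basis. B b"
  show thesis
  proof (rule that)
    show "0 \<le> ?L" using B0 by (simp add: sum_nonneg)
    fix z h
    have lin: "linear (frechet_derivative \<phi> (at z))"
      using test_function_has_derivative[OF \<phi>] by (rule has_derivative_linear)
    have "frechet_derivative \<phi> (at z) h = frechet_derivative \<phi> (at z) (\<Sum>b\<in>Basis. (h \<bullet> b) *\<^sub>R b)"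
      by (simp only: euclidean_representation)
    also have "\<dots> = (\<Sum>b\<in>Basis. (h \<bullet> b) * frechet_derivative \<phi> (at z) b)"
      using lin by (simp add: linear_sum linear_scale)
    also have "\<bar>\<dots>\<bar> \<le> (\<Sum>b\<in>Basis. norm h * B b)"
      by (rule order_trans[OF sum_abs])
         (auto intro!: sum_mono mult_mono simp: abs_mult Basis_le_norm B)
    finally show "\<bar>frechet_derivative \<phi> (at z) h\<bar> \<le> ?L * norm h"
      by (simp add: sum_distrib_left mult.commute)
  qed
qed

lemma lipschitz_of_derivative_bounded:
  fixes \<phi> :: "'a::real_normed_vector \<Rightarrow> real"
  assumes "\<And>z. (\<phi> has_derivative \<phi>' z) (at z)" "\<And>z h. \<bar>\<phi>' z h\<bar> \<le> L * norm h"
    and "0 \<le> L"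
  shows "\<bar>\<phi> x - \<phi> y\<bar> \<le> L * norm (x - y)"
proof -
  have "onorm (\<phi>' z) \<le> L" for z
  proof (rule onorm_bound)
    show "norm (\<phi>' z h) \<le> L * norm h" for h
      using assms(2)[of z h] by (simp only: real_norm_def)
  qed (rule assms(3))
  with assms(1) have "norm (\<phi> x - \<phi> y) \<le> L * norm (x - y)"
    by (intro differentiable_bound[of UNIV \<phi> \<phi>']) simp_all
  then show ?thesis by (simp only: real_norm_def)
qed

text \<open>Restricting to the steps \<open>1 / (n + 1)\<close> makes the right derivative a
  countable limit, as both measurability of the derivative and dominated convergence
  require.\<close>

lemma right_derivative_LIMSEQ:
  fixes f :: "real \<Rightarrow> 'a::real_normed_vector"
  assumes "(f has_vector_derivative D) (at t within {t..})"
  shows "(\<lambda>n. real (Suc n) *\<^sub>R (f (t + inverse (real (Suc n))) - f t)) \<longlonglongrightarrow> D"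
proof -
  let ?s = "\<lambda>n. t + inverse (real (Suc n))"
  let ?q = "\<lambda>y. (1 / norm (y - t)) *\<^sub>R (f y - (f t + (y - t) *\<^sub>R D))"
  have "(?q \<longlongrightarrow> 0) (at t within {t..})"
    using assms unfolding has_vector_derivative_def has_derivative_within by (rule conjunct2)
  moreover have "filterlim ?s (at t within {t..}) sequentially"
    unfolding filterlim_at
    using LIMSEQ_inverse_real_of_nat_add[of t] by (auto intro!: always_eventually)
  ultimately have "(\<lambda>n. ?q (?s n)) \<longlonglongrightarrow> 0" by (rule filterlim_compose)
  moreover have "?q (?s n) = real (Suc n) *\<^sub>R (f (?s n) - f t) - D" for n
    by (simp add: scaleR_diff_right inverse_eq_divide algebra_simps del: of_nat_Suc)
  ultimately have "(\<lambda>n. real (Suc n) *\<^sub>R (f (?s n) - f t) - D) \<longlonglongrightarrow> 0" by (simp only:)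
  then show ?thesis by (rule LIM_zero_cancel)
qed

text \<open>Separates factors depending only on the space-time point from the coordinates of
  \<open>w\<close>. Conditioning can then replace the coordinates of \<open>w\<close> one at a
  time.\<close>

lemma test_function_derivative_expand:
  assumes "test_function J \<phi>"
  shows "frechet_derivative \<phi> (at z) (1, w) = frechet_derivative \<phi> (at z) (1, 0)
    + (\<Sum>b\<in>Basis. frechet_derivative \<phi> (at z) (0, b) * (w \<bullet> b))"
proof -
  let ?D = "frechet_derivative \<phi> (at z)"
  have lin: "linear ?D"
    using test_function_has_derivative[OF assms] by (rule has_derivative_linear)
  have "(1, w) = (1, 0) + (\<Sum>b\<in>Basis. (w \<bullet> b) *\<^sub>R (0, b))"
    by (intro prod_eqI) (simp_all add: fst_sum snd_sum euclidean_representation)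
  then have "?D (1, w) = ?D ((1, 0) + (\<Sum>b\<in>Basis. (w \<bullet> b) *\<^sub>R (0, b)))"
    by (rule arg_cong)
  also have "\<dots> = ?D (1, 0) + (\<Sum>b\<in>Basis. (w \<bullet> b) * ?D (0, b))"
    by (simp only: linear_add[OF lin] linear_sum[OF lin] linear_scale[OF lin] real_scaleR_def)
  finally show ?thesis by (simp only: mult.commute)
qed

lemma test_function_time_bounded:
  assumes "test_function J \<phi>"
  obtains r where "0 \<le> r" "\<And>t x. r < \<bar>t\<bar> \<Longrightarrow> (t, x) \<notin> closure {z. \<phi> z \<noteq> 0}"
proof -
  have "bounded (closure {z. \<phi> z \<noteq> 0})"
    using assms unfolding test_function_def by (blast intro: compact_imp_bounded)
  then obtain r where r: "0 < r" "\<And>z. z \<in> closure {z. \<phi> z \<noteq> 0} \<Longrightarrow> norm z \<le> r"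
    unfolding bounded_pos by blast
  show thesis
  proof (rule that[of r])
    fix t x assume "r < \<bar>t\<bar>"
    then show "(t, x) \<notin> closure {z. \<phi> z \<noteq> 0}"
      using r(2)[of "(t, x)"] norm_fst_le[of t x] by (auto simp: norm_Pair1)
  qed (use r in simp)
qed

lemma test_function_lipschitz:
  assumes "test_function J (\<phi> :: real \<times> 'a::euclidean_space \<Rightarrow> real)"
  obtains L where "0 \<le> L" "\<And>x y. \<bar>\<phi> x - \<phi> y\<bar> \<le> L * norm (x - y)"
    "\<And>z h. \<bar>frechet_derivative \<phi> (at z) h\<bar> \<le> L * norm h"
  using test_function_derivative_bounded[OF assms]
    lipschitz_of_derivative_bounded[OF test_function_has_derivative[OF assms]] by metis

text \<open>Space-time has infinite measure, but a bounded time strip has finite measure since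
  \<open>M\<close> is a probability; there boundedness suffices.\<close>

lemma (in prob_space) integrable_time_strip:
  fixes u :: "real \<times> 'a \<Rightarrow> real"
  assumes [measurable]: "u \<in> borel_measurable (lborel \<Otimes>\<^sub>M M)"
    and bound: "\<And>z. z \<in> space (lborel \<Otimes>\<^sub>M M) \<Longrightarrow> \<bar>u z\<bar> \<le> B"
    and zero: "\<And>t \<omega>. r < \<bar>t\<bar> \<Longrightarrow> u (t, \<omega>) = 0"
  shows "integrable (lborel \<Otimes>\<^sub>M M) u"
proof (rule integrableI_bounded_set[of "{-r..r} \<times> space M"])
  show "emeasure (lborel \<Otimes>\<^sub>M M) ({-r..r} \<times> space M) < \<infinity>"
    by (subst emeasure_pair_measure_Times) (auto simp: emeasure_space_1 emeasure_lborel_Icc_eq)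
  show "AE z in lborel \<Otimes>\<^sub>M M. z \<notin> {-r..r} \<times> space M \<longrightarrow> u z = 0"
    by (rule AE_I2) (auto simp: space_pair_measure intro!: zero)
qed (use bound in \<open>auto intro!: AE_I2\<close>)

text \<open>The source of the dimension factor: d squared coordinates, each at most the square of
  \<open>k\<close>.\<close>

lemma norm_square_le_of_coords:
  fixes w :: "'a::euclidean_space"
  assumes "\<And>b. b \<in> Basis \<Longrightarrow> \<bar>w \<bullet> b\<bar> \<le> k"
  shows "(norm w)\<^sup>2 \<le> real DIM('a) * k\<^sup>2"
proof -
  have "(norm w)\<^sup>2 = (\<Sum>b\<in>Basis. \<bar>w \<bullet> b\<bar>\<^sup>2)"
    unfolding power2_norm_eq_inner euclidean_inner[of w w] by (simp add: power2_eq_square)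
  also have "\<dots> \<le> (\<Sum>b\<in>(Basis :: 'a set). k\<^sup>2)"
    using assms by (intro sum_mono power_mono) auto
  finally show ?thesis by simp
qed

lemma norm_le_of_coords:
  fixes w :: "'a::euclidean_space"
  assumes "\<And>b. b \<in> Basis \<Longrightarrow> \<bar>w \<bullet> b\<bar> \<le> k" and "0 \<le> k"
  shows "norm w \<le> sqrt (real DIM('a)) * k"
  using real_le_rsqrt[OF norm_square_le_of_coords[OF assms(1)]] assms(2)
  by (simp add: real_sqrt_mult)

section \<open>Processes with Lipschitz, right-differentiable paths\<close>

text \<open>The assumptions hold for every \<omega> and all real times rather than almost surely and
  for \<open>t \<ge> 0\<close>: pointwise limits then need no exceptional sets, and time may be
  shifted freely along the whole line.\<close>

locale lipschitz_process = prob_space M for M :: "'w measure" +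
  fixes Y :: "real \<Rightarrow> 'w \<Rightarrow> 'a::euclidean_space" and c :: real
  assumes measurable_Y: "\<And>t. Y t \<in> borel_measurable M"
    and coord_lipschitz: "\<And>\<omega> s t b. \<omega> \<in> space M \<Longrightarrow> b \<in> Basis \<Longrightarrow>
      \<bar>(Y t \<omega> - Y s \<omega>) \<bullet> b\<bar> \<le> c * \<bar>t - s\<bar>"
    and right_differentiable: "\<And>\<omega> t. \<omega> \<in> space M \<Longrightarrow>
      \<exists>D. ((\<lambda>s. Y s \<omega>) has_vector_derivative D) (at t within {t..})"
begin

text \<open>A right derivative is unique, so on \<open>space M\<close> the choice operator selects
  the only candidate.\<close>

definition V :: "real \<Rightarrow> 'w \<Rightarrow> 'a" where
  "V t \<omega> = (SOME D. ((\<lambda>s. Y s \<omega>) has_vector_derivative D) (at t within {t..}))"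

text \<open>Its image of \<open>lborel \<Otimes>\<^sub>M M\<close> is the space-time measure with
  the laws of \<open>Y t\<close> as time slices; functions of \<open>flow\<close> are exactly
  functions of time and position.\<close>

definition flow :: "real \<times> 'w \<Rightarrow> real \<times> 'a" where
  "flow z = (fst z, Y (fst z) (snd z))"

lemma c_nonneg: "0 \<le> c"
proof -
  obtain \<omega> where "\<omega> \<in> space M" using not_empty by blast
  moreover obtain b :: 'a where "b \<in> Basis" using nonempty_Basis by blast
  ultimately show ?thesis using coord_lipschitz[of \<omega> b 1 0] by simp
qed

lemma lipschitz:
  assumes "\<omega> \<in> space M"
  shows "norm (Y t \<omega> - Y s \<omega>) \<le> sqrt (real DIM('a)) * c * \<bar>t - s\<bar>"
  using norm_le_of_coords[OF coord_lipschitz[OF assms]] c_nonneg by (simp add: mult.assoc)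

lemma continuous_Y: "\<omega> \<in> space M \<Longrightarrow> continuous_on UNIV (\<lambda>t. Y t \<omega>)"
  using lipschitz c_nonneg
  by (intro lipschitz_on_continuous_on[of "sqrt (real DIM('a)) * c"] lipschitz_onI) (auto simp: dist_norm)

lemma measurable_Y_pair[measurable]: "(\<lambda>z. Y (fst z) (snd z)) \<in> borel_measurable (borel \<Otimes>\<^sub>M M)"
  using borel_measurable_continuous_process[OF measurable_Y continuous_Y]
  by (simp add: case_prod_beta)

lemma measurable_Y_pair_lborel[measurable]: "(\<lambda>z. Y (fst z) (snd z)) \<in> borel_measurable (lborel \<Otimes>\<^sub>M M)"
  using measurable_Y_pair by (simp cong: measurable_cong_sets)

lemma measurable_Y_shift[measurable]:
  "(\<lambda>z. Y (fst z + h) (snd z)) \<in> borel_measurable (lborel \<Otimes>\<^sub>M M)"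
  using measurable_compose[of "\<lambda>z. (fst z + h, snd z)" "lborel \<Otimes>\<^sub>M M" "borel \<Otimes>\<^sub>M M", OF _ measurable_Y_pair]
  by simp

lemma measurable_flow[measurable]: "flow \<in> borel_measurable (lborel \<Otimes>\<^sub>M M)"
  unfolding flow_def by simp

lemma V: "\<omega> \<in> space M \<Longrightarrow> ((\<lambda>s. Y s \<omega>) has_vector_derivative V t \<omega>) (at t within {t..})"
  unfolding V_def by (rule someI_ex) (rule right_differentiable)

lemma V_LIMSEQ:
  "\<omega> \<in> space M \<Longrightarrow>
    (\<lambda>n. real (Suc n) *\<^sub>R (Y (t + inverse (real (Suc n))) \<omega> - Y t \<omega>)) \<longlonglongrightarrow> V t \<omega>"
  by (rule right_derivative_LIMSEQ) (rule V)

lemma measurable_V[measurable]: "(\<lambda>z. V (fst z) (snd z)) \<in> borel_measurable (lborel \<Otimes>\<^sub>M M)"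
proof (rule borel_measurable_LIMSEQ_metric)
  show "(\<lambda>z. real (Suc n) *\<^sub>R (Y (fst z + inverse (real (Suc n))) (snd z) - Y (fst z) (snd z)))
      \<in> borel_measurable (lborel \<Otimes>\<^sub>M M)" for n
    by simp
qed (auto simp: space_pair_measure simp del: of_nat_Suc intro!: V_LIMSEQ)

lemma V_bounded:
  assumes \<omega>: "\<omega> \<in> space M" and b: "b \<in> Basis"
  shows "\<bar>V t \<omega> \<bullet> b\<bar> \<le> c"
proof (rule LIMSEQ_le_const2)
  show "(\<lambda>n. \<bar>(real (Suc n) *\<^sub>R (Y (t + inverse (real (Suc n))) \<omega> - Y t \<omega>)) \<bullet> b\<bar>) \<longlonglongrightarrow> \<bar>V t \<omega> \<bullet> b\<bar>"
    by (intro tendsto_rabs tendsto_inner V_LIMSEQ \<omega> tendsto_const)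
  have "\<bar>(real (Suc n) *\<^sub>R (Y (t + inverse (real (Suc n))) \<omega> - Y t \<omega>)) \<bullet> b\<bar> \<le> c" for n
  proof -
    have "\<bar>(real (Suc n) *\<^sub>R (Y (t + inverse (real (Suc n))) \<omega> - Y t \<omega>)) \<bullet> b\<bar>
        = real (Suc n) * \<bar>(Y (t + inverse (real (Suc n))) \<omega> - Y t \<omega>) \<bullet> b\<bar>"
      by (simp only: inner_scaleR_left abs_mult abs_of_nat)
    also have "\<dots> \<le> real (Suc n) * (c * inverse (real (Suc n)))"
      using coord_lipschitz[OF \<omega> b, of "t + inverse (real (Suc n))" t]
      by (intro mult_left_mono) (auto simp del: of_nat_Suc)
    also have "\<dots> = c" by (simp add: field_simps)
    finally show ?thesis .
  qed
  then show "\<exists>N. \<forall>n\<ge>N. \<bar>(real (Suc n) *\<^sub>R (Y (t + inverse (real (Suc n))) \<omega> - Y t \<omega>)) \<bullet> b\<bar> \<le> c"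
    by blast
qed

text \<open>Images of sigma-finite measures can fail to be sigma-finite. Here \<open>flow\<close>
  keeps the time coordinate, so the slab of times between \<open>-n\<close> and \<open>n\<close> has
  mass \<open>2 * n\<close>.\<close>

lemma sigma_finite_flow: "sigma_finite_measure (distr (lborel \<Otimes>\<^sub>M M) borel flow)"
proof
  let ?D = "distr (lborel \<Otimes>\<^sub>M M) borel flow"
  let ?A = "\<lambda>n::nat. {- real n..real n} \<times> (UNIV :: 'a set)"
  have [measurable]: "?A n \<in> sets borel" for n
    by (intro borel_closed closed_Times) auto
  have "emeasure ?D (?A n) \<noteq> \<infinity>" for n
  proof -
    have "flow -` ?A n \<inter> space (lborel \<Otimes>\<^sub>M M) = {- real n..real n} \<times> space M"
      by (auto simp: flow_def space_pair_measure)
    then have "emeasure ?D (?A n) = emeasure (lborel \<Otimes>\<^sub>M M) ({- real n..real n} \<times> space M)"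
      by (simp add: emeasure_distr)
    also have "\<dots> = ennreal (2 * real n)"
      by (subst emeasure_pair_measure_Times) (auto simp: emeasure_space_1 emeasure_lborel_Icc_eq)
    finally show ?thesis by simp
  qed
  moreover have "\<Union>(range ?A) = UNIV"
  proof (intro set_eqI iffI UNIV_I)
    fix z :: "real \<times> 'a"
    obtain n :: nat where "\<bar>fst z\<bar> \<le> real n" using real_arch_simple by blast
    then have "z \<in> ?A n" by (cases z) auto
    then show "z \<in> \<Union>(range ?A)" by blast
  qed
  ultimately show "\<exists>A. countable A \<and> A \<subseteq> sets ?D \<and> \<Union>A = space ?D \<and> (\<forall>a\<in>A. emeasure ?D a \<noteq> \<infinity>)"
    by (intro exI[of _ "range ?A"]) auto
qed

lemma flow_apply[simp]: "flow (t, \<omega>) = (t, Y t \<omega>)"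
  by (simp add: flow_def)

section \<open>The continuity equation for the laws\<close>

lemma right_derivative_along_path:
  assumes \<phi>: "test_function J \<phi>" and \<omega>: "\<omega> \<in> space M"
  shows "((\<lambda>s. \<phi> (s, Y s \<omega>)) has_vector_derivative
      frechet_derivative \<phi> (at (t, Y t \<omega>)) (1, V t \<omega>)) (at t within {t..})"
proof -
  have "((\<lambda>s. (s, Y s \<omega>)) has_vector_derivative (1, V t \<omega>)) (at t within {t..})"
    by (intro has_vector_derivative_Pair V \<omega> has_vector_derivative_id)
  from vector_derivative_diff_chain_within[OF this has_derivative_at_withinI[OF test_function_has_derivative[OF \<phi>]]]
  show ?thesis by (simp only: comp_def)
qed

lemma borel_measurable_test_derivative:
  assumes "test_function J \<phi>"
  shows "(\<lambda>z. frechet_derivative \<phi> (at z) h) \<in> borel_measurable borel"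
  using test_function_continuous_derivative[OF assms] by (rule borel_measurable_continuous_onI)

lemma integrable_test_derivative:
  assumes \<phi>: "test_function J \<phi>" and [measurable]: "u \<in> borel_measurable (lborel \<Otimes>\<^sub>M M)"
    and u: "\<And>z. z \<in> space (lborel \<Otimes>\<^sub>M M) \<Longrightarrow> \<bar>u z\<bar> \<le> B"
  shows "integrable (lborel \<Otimes>\<^sub>M M) (\<lambda>z. frechet_derivative \<phi> (at (flow z)) h * u z)"
proof -
  obtain r where r: "\<And>t x. r < \<bar>t\<bar> \<Longrightarrow> (t, x) \<notin> closure {z. \<phi> z \<noteq> 0}"
    using test_function_time_bounded[OF \<phi>] by metis
  obtain L where L: "0 \<le> L" "\<And>z h. \<bar>frechet_derivative \<phi> (at z) h\<bar> \<le> L * norm h"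
    using test_function_derivative_bounded[OF \<phi>] by metis
  have [measurable]: "(\<lambda>z. frechet_derivative \<phi> (at (flow z)) h) \<in> borel_measurable (lborel \<Otimes>\<^sub>M M)"
    by (rule measurable_compose[OF measurable_flow borel_measurable_test_derivative[OF \<phi>]])
  show ?thesis
  proof (rule integrable_time_strip)
    show "\<bar>frechet_derivative \<phi> (at (flow z)) h * u z\<bar> \<le> L * norm h * B"
      if "z \<in> space (lborel \<Otimes>\<^sub>M M)" for z
      unfolding abs_mult using L(1) by (intro mult_mono u that L(2)) simp_all
    show "frechet_derivative \<phi> (at (flow (t, \<omega>))) h * u (t, \<omega>) = 0" if "r < \<bar>t\<bar>" for t \<omega>
      using test_function_derivative_eq_0[OF \<phi> r[OF that]] by simp
  qed measurable
qed

lemma integral_derivative_along_paths: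
  assumes \<phi>: "test_function J \<phi>"
  shows "(\<integral>z. frechet_derivative \<phi> (at (flow z)) (1, V (fst z) (snd z)) \<partial>(lborel \<Otimes>\<^sub>M M)) = 0"
proof -
  let ?P = "(lborel :: real measure) \<Otimes>\<^sub>M M"
  interpret P: pair_sigma_finite lborel M ..
  obtain r where r0: "0 \<le> r" and r: "\<And>t x. r < \<bar>t\<bar> \<Longrightarrow> (t, x) \<notin> closure {z. \<phi> z \<noteq> 0}"
    using test_function_time_bounded[OF \<phi>] by metis
  obtain L where L: "0 \<le> L" "\<And>x y. \<bar>\<phi> x - \<phi> y\<bar> \<le> L * norm (x - y)"
    using test_function_lipschitz[OF \<phi>] by metis
  have \<phi>0: "\<phi> (t, x) = 0" if "r < \<bar>t\<bar>" for t x
    using r[OF that, of x] closure_subset[of "{z. \<phi> z \<noteq> 0}"] by auto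
  have \<phi>_bound: "\<bar>\<phi> (t, x)\<bar> \<le> L * (2 * r + 1)" for t x
  proof (cases "r < \<bar>t\<bar>")
    case True
    then show ?thesis using \<phi>0 L(1) r0 by simp
  next
    case False
    \<comment> \<open>\<open>\<phi>\<close> vanishes at time \<open>r + 1\<close>, which is at
      distance at most \<open>2 * r + 1\<close> from every time in the strip.\<close>
    have "\<bar>\<phi> (t, x) - \<phi> (r + 1, x)\<bar> \<le> L * norm ((t, x) - (r + 1, x))" by (rule L(2))
    also have "\<dots> \<le> L * (2 * r + 1)"
      using False by (intro mult_left_mono L(1)) (auto simp: norm_Pair1)
    finally show ?thesis using \<phi>0[of "r + 1" x] r0 by simp
  qed
  have [measurable]: "\<phi> \<in> borel_measurable borel"
    using \<phi> unfolding test_function_def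
    by (metis borel_measurable_continuous_onI k_times_cont_diff.simps(1))
  have meas[measurable]: "(\<lambda>z. \<phi> (fst z + h, Y (fst z + h) (snd z))) \<in> borel_measurable ?P" for h
    by measurable
  have int: "integrable ?P (\<lambda>z. \<phi> (fst z + h, Y (fst z + h) (snd z)))" for h
  proof (rule integrable_time_strip[OF meas \<phi>_bound])
    show "\<phi> (fst (t, \<omega>) + h, Y (fst (t, \<omega>) + h) (snd (t, \<omega>))) = 0" if "r + \<bar>h\<bar> < \<bar>t\<bar>" for t \<omega>
      using that by (intro \<phi>0) auto
  qed
  \<comment> \<open>The right-hand side does not contain \<open>h\<close>; hence every difference
    quotient \<open>?q n\<close> integrates to 0.\<close>
  have shift: "(\<integral>z. \<phi> (fst z + h, Y (fst z + h) (snd z)) \<partial>?P) = (\<integral>t. (\<integral>\<omega>. \<phi> (t, Y t \<omega>) \<partial>M) \<partial>lborel)" for h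
    using lborel_integral_real_affine[of 1 "\<lambda>t. \<integral>\<omega>. \<phi> (t, Y t \<omega>) \<partial>M" h] P.integral_fst'[OF int[of h]]
    by (simp add: add.commute)
  let ?q = "\<lambda>n z. real (Suc n) *\<^sub>R (\<phi> (fst z + inverse (real (Suc n)), Y (fst z + inverse (real (Suc n))) (snd z))
      - \<phi> (fst z, Y (fst z) (snd z)))"
  have int_q: "(\<integral>z. ?q n z \<partial>?P) = 0" for n
    using shift[of 0] shift[of "inverse (real (Suc n))"] int[of 0] int[of "inverse (real (Suc n))"]
    by (simp del: of_nat_Suc)
  have [measurable]: "(\<lambda>z. frechet_derivative \<phi> (at (flow z)) (1, V (fst z) (snd z))) \<in> borel_measurable ?P"
    unfolding test_function_derivative_expand[OF \<phi>, of _ "V _ _"]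
    using measurable_compose[OF measurable_flow borel_measurable_test_derivative[OF \<phi>]] by measurable
  have "(\<lambda>n. \<integral>z. ?q n z \<partial>?P) \<longlonglongrightarrow> (\<integral>z. frechet_derivative \<phi> (at (flow z)) (1, V (fst z) (snd z)) \<partial>?P)"
  proof (rule integral_dominated_convergence)
    \<comment> \<open>In a step \<open>h\<close> the time coordinate moves by \<open>h\<close> and
      the position by at most \<open>sqrt d * c * h\<close>; dividing by \<open>h\<close> and
      multiplying by the Lipschitz constant \<open>L\<close> gives this bound.\<close>
    let ?B = "L * (1 + sqrt (real DIM('a)) * c)"
    show "integrable ?P (\<lambda>z. ?B * indicator ({- (r + 1)..r + 1} \<times> space M) z)"
      by (rule integrable_time_strip[of _ ?B "r + 1"])
         (use L(1) c_nonneg in \<open>auto simp: indicator_def\<close>)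
    show "AE z in ?P. (\<lambda>n. ?q n z) \<longlonglongrightarrow> frechet_derivative \<phi> (at (flow z)) (1, V (fst z) (snd z))"
    proof (rule AE_I2)
      fix z assume "z \<in> space ?P"
      then have "snd z \<in> space M" by (auto simp: space_pair_measure)
      from right_derivative_LIMSEQ[OF right_derivative_along_path[OF \<phi> this]]
      show "(\<lambda>n. ?q n z) \<longlonglongrightarrow> frechet_derivative \<phi> (at (flow z)) (1, V (fst z) (snd z))"
        by (simp only: flow_def)
    qed
    show "AE z in ?P. norm (?q n z) \<le> ?B * indicator ({- (r + 1)..r + 1} \<times> space M) z" for n
    proof (rule AE_I2)
      fix z assume z: "z \<in> space ?P"
      obtain t \<omega> where [simp]: "z = (t, \<omega>)" by (cases z)
      have \<omega>: "\<omega> \<in> space M" using z by (simp add: space_pair_measure)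
      let ?h = "inverse (real (Suc n))"
      have h: "0 < ?h" "?h \<le> 1" by (auto simp: inverse_le_1_iff)
      show "norm (?q n z) \<le> ?B * indicator ({- (r + 1)..r + 1} \<times> space M) z"
      proof (cases "t \<in> {- (r + 1)..r + 1}")
        case True
        have "norm ((t + ?h, Y (t + ?h) \<omega>) - (t, Y t \<omega>)) \<le> ?h + sqrt (real DIM('a)) * c * ?h"
          using lipschitz[OF \<omega>, of "t + ?h" t] norm_Pair_le[of ?h "Y (t + ?h) \<omega> - Y t \<omega>"] h
          by (simp del: of_nat_Suc)
        then have "\<bar>\<phi> (t + ?h, Y (t + ?h) \<omega>) - \<phi> (t, Y t \<omega>)\<bar> \<le> L * (?h + sqrt (real DIM('a)) * c * ?h)"
          using L by (meson mult_left_mono order_trans)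
        then have "real (Suc n) * \<bar>\<phi> (t + ?h, Y (t + ?h) \<omega>) - \<phi> (t, Y t \<omega>)\<bar>
            \<le> real (Suc n) * (L * (?h + sqrt (real DIM('a)) * c * ?h))"
          by (rule mult_left_mono) simp
        also have "\<dots> = ?B" by (simp add: field_simps)
        finally show ?thesis using True \<omega> by (simp add: abs_mult del: of_nat_Suc)
      next
        case False
        \<comment> \<open>The strip is widened by 1 because steps are at most 1: outside it both
          endpoints miss the support.\<close>
        then have "r < \<bar>t\<bar>" "r < \<bar>t + ?h\<bar>" using h r0 unfolding atLeastAtMost_iff by linarith+
        then show ?thesis using False by (auto simp: \<phi>0 indicator_def simp del: of_nat_Suc)
      qed
    qed
  qed measurable
  then show ?thesis unfolding int_q using LIMSEQ_unique tendsto_const by blast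
qed

text \<open>\<open>\<mu>\<close> is tied to \<open>Y\<close> only at times in \<open>J\<close>,
  while the vanishing integral runs over all times. The two fit together because test functions are
  supported in \<open>J \<times> UNIV\<close>.\<close>

lemma velocity_field_exists:
  assumes \<mu>: "\<And>t. t \<in> J \<Longrightarrow> \<mu> t = distr M borel (Y t)"
  obtains v where "velocity_field J \<mu> v" "\<And>t x b. b \<in> Basis \<Longrightarrow> \<bar>v t x \<bullet> b\<bar> \<le> c"
proof -
  let ?P = "(lborel :: real measure) \<Otimes>\<^sub>M M"
  interpret P: pair_sigma_finite lborel M ..
  have "\<forall>b\<in>Basis. \<exists>f. f \<in> borel_measurable borel \<and> (\<forall>y. \<bar>f y\<bar> \<le> c) \<and>
      (\<forall>\<psi>. \<psi> \<in> borel_measurable borel \<longrightarrow> integrable ?P (\<lambda>z. \<psi> (flow z)) \<longrightarrow>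
        (\<integral>z. \<psi> (flow z) * (V (fst z) (snd z) \<bullet> b) \<partial>?P) = (\<integral>z. \<psi> (flow z) * f (flow z) \<partial>?P))"
  proof
    fix b :: 'a assume b: "b \<in> Basis"
    have V1: "(\<lambda>z. V (fst z) (snd z) \<bullet> b) \<in> borel_measurable ?P" by measurable
    have V2: "\<bar>V (fst z) (snd z) \<bullet> b\<bar> \<le> c" if "z \<in> space ?P" for z
      using that b by (intro V_bounded) (auto simp: space_pair_measure)
    obtain f where "f \<in> borel_measurable borel" "\<And>y. \<bar>f y\<bar> \<le> c"
      "\<And>\<psi>. \<psi> \<in> borel_measurable borel \<Longrightarrow> integrable ?P (\<lambda>z. \<psi> (flow z)) \<Longrightarrow>
        (\<integral>z. \<psi> (flow z) * (V (fst z) (snd z) \<bullet> b) \<partial>?P) = (\<integral>z. \<psi> (flow z) * f (flow z) \<partial>?P)"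
      by (rule bounded_density_of_image[OF sigma_finite_flow measurable_flow V1 V2 c_nonneg]) simp_all
    then show "\<exists>f. f \<in> borel_measurable borel \<and> (\<forall>y. \<bar>f y\<bar> \<le> c) \<and>
      (\<forall>\<psi>. \<psi> \<in> borel_measurable borel \<longrightarrow> integrable ?P (\<lambda>z. \<psi> (flow z)) \<longrightarrow>
        (\<integral>z. \<psi> (flow z) * (V (fst z) (snd z) \<bullet> b) \<partial>?P) = (\<integral>z. \<psi> (flow z) * f (flow z) \<partial>?P))"
      by (intro exI[of _ f] conjI allI impI) simp_all
  qed
  from bchoice[OF this] obtain f where f[measurable]: "\<And>b. b \<in> Basis \<Longrightarrow> f b \<in> borel_measurable borel"
    and f_bound: "\<And>b y. b \<in> Basis \<Longrightarrow> \<bar>f b y\<bar> \<le> c"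
    and f_int: "\<And>b \<psi>. b \<in> Basis \<Longrightarrow> \<psi> \<in> borel_measurable borel \<Longrightarrow> integrable ?P (\<lambda>z. \<psi> (flow z)) \<Longrightarrow>
        (\<integral>z. \<psi> (flow z) * (V (fst z) (snd z) \<bullet> b) \<partial>?P) = (\<integral>z. \<psi> (flow z) * f b (flow z) \<partial>?P)"
    by blast
  define v where "v t x = (\<Sum>b\<in>Basis. f b (t, x) *\<^sub>R b)" for t x
  have v_inner: "v t x \<bullet> b = f b (t, x)" if "b \<in> Basis" for t x b
    using that by (simp add: v_def)
  have v_norm: "norm (v t x) \<le> sqrt (real DIM('a)) * c" for t x
    by (rule norm_le_of_coords) (simp_all add: v_inner f_bound c_nonneg)
  have v_meas: "(\<lambda>(t, x). v t x) \<in> borel_measurable borel"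
    unfolding v_def case_prod_beta prod.collapse by (auto intro!: borel_measurable_sum borel_measurable_scaleR f)
  have prob: "prob_space (\<mu> t)" "sets (\<mu> t) = sets borel" if "t \<in> J" for t
    using \<mu>[OF that] measurable_Y by (auto intro: prob_space_distr)
  have v_expand: "frechet_derivative \<phi> (at (t, x)) (1, v t x) = frechet_derivative \<phi> (at (t, x)) (1, 0)
      + (\<Sum>b\<in>Basis. frechet_derivative \<phi> (at (t, x)) (0, b) * f b (t, x))"
    if "test_function J \<phi>" for \<phi> t x
    unfolding test_function_derivative_expand[OF that, of _ "v t x"] by (simp add: v_inner)
  have "velocity_field J \<mu> v"
    unfolding velocity_field_def
  proof (intro conjI allI impI)
    show "(\<lambda>(t, x). v t x) \<in> borel_measurable borel" by (rule v_meas)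
  next
    fix C :: "(real \<times> 'a) set" assume C: "compact C \<and> C \<subseteq> J \<times> UNIV"
    then have "bounded C" by (blast intro: compact_imp_bounded)
    then obtain r where r: "\<And>z. z \<in> C \<Longrightarrow> norm z \<le> r" unfolding bounded_iff by blast
    let ?K = "ennreal (sqrt (real DIM('a)) * c)"
    have "(\<integral>\<^sup>+ t. (\<integral>\<^sup>+ x. indicator C (t, x) * ennreal (norm (v t x)) \<partial>\<mu> t) \<partial>lborel)
        \<le> (\<integral>\<^sup>+ t. ?K * indicator {-r..r} t \<partial>lborel)"
    proof (rule nn_integral_mono)
      fix t
      show "(\<integral>\<^sup>+ x. indicator C (t, x) * ennreal (norm (v t x)) \<partial>\<mu> t) \<le> ?K * indicator {-r..r} t"
      proof (cases "t \<in> J")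
        case True
        interpret \<mu>t: prob_space "\<mu> t" by (rule prob[OF True])
        have "indicator C (t, x) \<le> (indicator {-r..r} t :: ennreal)" for x
          using r[of "(t, x)"] norm_fst_le[of t x] by (auto simp: indicator_def)
        then have "(\<integral>\<^sup>+ x. indicator C (t, x) * ennreal (norm (v t x)) \<partial>\<mu> t) \<le> (\<integral>\<^sup>+ x. indicator {-r..r} t * ?K \<partial>\<mu> t)"
          by (intro nn_integral_mono mult_mono ennreal_leI v_norm) auto
        then show ?thesis by (simp add: \<mu>t.emeasure_space_1 mult.commute)
      next
        case False
        \<comment> \<open>Nothing is known about \<open>\<mu> t\<close> here, but the slice of
          \<open>C\<close> at \<open>t\<close> is empty.\<close>
        then have "indicator C (t, x) = (0 :: ennreal)" for x using C by (auto simp: indicator_def)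
        then show ?thesis by simp
      qed
    qed
    also have "\<dots> < \<infinity>"
      by (simp add: nn_integral_cmult_indicator emeasure_lborel_Icc_eq ennreal_mult_less_top)
    finally show "(\<integral>\<^sup>+ t. (\<integral>\<^sup>+ x. indicator C (t, x) * ennreal (norm (v t x)) \<partial>\<mu> t) \<partial>lborel) < \<infinity>" .
  next
    fix \<phi> :: "real \<times> 'a \<Rightarrow> real" assume \<phi>: "test_function J \<phi>"
    let ?D = "\<lambda>z. frechet_derivative \<phi> (at z)"
    note [measurable] = borel_measurable_test_derivative[OF \<phi>]
    let ?V = "\<lambda>z b. V (fst z) (snd z) \<bullet> b"
    have fm: "(\<lambda>z. f b (flow z)) \<in> borel_measurable ?P" if "b \<in> Basis" for b
      by (rule measurable_compose[OF measurable_flow f[OF that]])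
    have i0: "integrable ?P (\<lambda>z. ?D (flow z) h)" for h
      using integrable_test_derivative[OF \<phi>, of "\<lambda>_. 1" 1 h] by simp
    have iV: "integrable ?P (\<lambda>z. ?D (flow z) (0, b) * ?V z b)" if "b \<in> Basis" for b
      by (rule integrable_test_derivative[OF \<phi>]) (use that V_bounded in \<open>auto simp: space_pair_measure\<close>)
    have iF: "integrable ?P (\<lambda>z. ?D (flow z) (0, b) * f b (flow z))" if "b \<in> Basis" for b
      by (rule integrable_test_derivative[OF \<phi> fm]) (use that f_bound in auto)
    \<comment> \<open>The integrand of the continuity equation, pulled back along
      \<open>flow\<close>.\<close>
    define G where "G z = ?D (flow z) (1, v (fst z) (Y (fst z) (snd z)))" for z
    have G: "G z = ?D (flow z) (1, 0) + (\<Sum>b\<in>Basis. ?D (flow z) (0, b) * f b (flow z))" for z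
      unfolding G_def flow_def by (rule v_expand[OF \<phi>])
    have G_int: "integrable ?P G"
      unfolding G[abs_def] by (intro Bochner_Integration.integrable_add Bochner_Integration.integrable_sum i0 iF)
    have "(\<integral>z. G z \<partial>?P) = (\<integral>z. ?D (flow z) (1, 0) \<partial>?P) + (\<Sum>b\<in>Basis. \<integral>z. ?D (flow z) (0, b) * f b (flow z) \<partial>?P)"
      unfolding G using i0 iF by simp
    \<comment> \<open>The defining property of the conditional density, with \<open>\<psi>\<close>
      the derivative of \<open>\<phi>\<close> in direction \<open>(0, b)\<close>, exchanges
      \<open>v\<close> for the true velocity \<open>V\<close>.\<close>
    also have "\<dots> = (\<integral>z. ?D (flow z) (1, 0) \<partial>?P) + (\<Sum>b\<in>Basis. \<integral>z. ?D (flow z) (0, b) * ?V z b \<partial>?P)"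
      using i0 by (intro arg_cong2[where f = "(+)"] sum.cong refl f_int[symmetric]) auto
    also have "\<dots> = (\<integral>z. ?D (flow z) (1, V (fst z) (snd z)) \<partial>?P)"
      unfolding test_function_derivative_expand[OF \<phi>, of _ "V _ _"] using i0 iV by simp
    also have "\<dots> = 0" by (rule integral_derivative_along_paths[OF \<phi>])
    finally have G_0: "(\<integral>z. G z \<partial>?P) = 0" .
    define g where "g = (\<lambda>t. \<integral>x. deriv (\<lambda>s. \<phi> (s, x)) t + frechet_derivative (\<lambda>y. \<phi> (t, y)) (at x) (v t x) \<partial>\<mu> t)"
    have g: "indicator J t *\<^sub>R g t = (\<integral>\<omega>. G (t, \<omega>) \<partial>M)" for t
    proof (cases "t \<in> J")
      case True
      have "(\<lambda>x. ?D (t, x) (1, v t x)) \<in> borel_measurable borel"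
        unfolding v_expand[OF \<phi>]
        by (intro borel_measurable_add borel_measurable_sum borel_measurable_times
            measurable_compose[OF _ borel_measurable_test_derivative[OF \<phi>]] measurable_compose[OF _ f])
           auto
      then show ?thesis
        unfolding g_def test_function_split_derivative[OF \<phi>] \<mu>[OF True]
        using True measurable_Y by (simp add: integral_distr G_def)
    next
      case False
      then have "(t, x) \<notin> closure {z. \<phi> z \<noteq> 0}" for x
        using \<phi> unfolding test_function_def by blast
      then show ?thesis using False by (simp add: G_def test_function_derivative_eq_0[OF \<phi>])
    qed
    show "let g = (\<lambda>t. \<integral>x. deriv (\<lambda>s. \<phi> (s, x)) t + frechet_derivative (\<lambda>y. \<phi> (t, y)) (at x) (v t x) \<partial>\<mu> t)
         in set_integrable lborel J g \<and> (LBINT t:J. g t) = 0"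
      unfolding Let_def g_def[symmetric] set_integrable_def set_lebesgue_integral_def g
      using P.integrable_fst'[OF G_int] P.integral_fst'[OF G_int] G_0 by simp
  qed
  then show thesis using that v_inner f_bound by simp
qed

section \<open>Wasserstein, moment and support bounds for the laws\<close>

lemma W2_le:
  "W2 (distr M borel (Y s)) (distr M borel (Y t)) \<le> sqrt (real DIM('a)) * c * \<bar>s - t\<bar>"
  using lipschitz c_nonneg
  by (intro W2_le_of_coupling[OF prob_space_axioms] measurable_Y AE_I2) (auto simp: dist_norm)

lemma distr_in_P2:
  assumes "distr M borel (Y s) \<in> P2"
  shows "distr M borel (Y t) \<in> P2"
proof -
  note [measurable] = measurable_Y
  let ?r = "sqrt (real DIM('a)) * c * \<bar>t - s\<bar>"
  have "integrable M (\<lambda>\<omega>. (norm (Y s \<omega>))\<^sup>2)"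
    using assms by (auto simp: P2_def integrable_distr_eq)
  then have "integrable M (\<lambda>\<omega>. 2 * (norm (Y s \<omega>))\<^sup>2 + 2 * ?r\<^sup>2)" by simp
  then have "integrable M (\<lambda>\<omega>. (norm (Y t \<omega>))\<^sup>2)"
  proof (rule Bochner_Integration.integrable_bound)
    show "AE \<omega> in M. norm ((norm (Y t \<omega>))\<^sup>2) \<le> norm (2 * (norm (Y s \<omega>))\<^sup>2 + 2 * ?r\<^sup>2)"
    proof (rule AE_I2)
      fix \<omega> assume "\<omega> \<in> space M"
      then have "norm (Y t \<omega>) \<le> norm (Y s \<omega>) + ?r"
        using lipschitz[of \<omega> t s] norm_triangle_sub[of "Y t \<omega>" "Y s \<omega>"] by linarith
      then have "(norm (Y t \<omega>))\<^sup>2 \<le> (norm (Y s \<omega>) + ?r)\<^sup>2" by (intro power_mono) auto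
      \<comment> \<open>The difference of the two sides is the square of
        \<open>norm (Y s \<omega>) - ?r\<close>.\<close>
      also have "\<dots> \<le> 2 * (norm (Y s \<omega>))\<^sup>2 + 2 * ?r\<^sup>2"
        using zero_le_power2[of "norm (Y s \<omega>) - ?r"] by (simp add: power2_sum power2_diff)
      finally show "norm ((norm (Y t \<omega>))\<^sup>2) \<le> norm (2 * (norm (Y s \<omega>))\<^sup>2 + 2 * ?r\<^sup>2)" by simp
    qed
  qed measurable
  then show ?thesis by (auto simp: P2_def integrable_distr_eq intro!: prob_space_distr)
qed

lemma supp_subset:
  "supp (distr M borel (Y t)) \<subseteq> (\<Union>x\<in>supp (distr M borel (Y s)). cball x (sqrt (real DIM('a)) * c * \<bar>s - t\<bar>))"
  using lipschitz by (intro supp_subset_of_dist_le measurable_Y AE_I2) (auto simp: dist_norm)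

end

section \<open>The Kac process in several dimensions\<close>

lemma has_vector_derivative_vec:
  fixes f :: "real \<Rightarrow> real ^ 'n"
  assumes "\<And>i. ((\<lambda>s. f s $ i) has_vector_derivative D i) F"
  shows "(f has_vector_derivative (\<chi> i. D i)) F"
proof -
  have "((\<lambda>s. \<Sum>i\<in>UNIV. f s $ i *\<^sub>R (axis i 1 :: real ^ 'n)) has_vector_derivative (\<Sum>i\<in>UNIV. D i *\<^sub>R axis i 1)) F"
    using assms unfolding has_vector_derivative_def
    by (auto intro!: derivative_eq_intros simp: scaleR_sum_right)
  moreover have eq: "(\<Sum>i\<in>UNIV. x i *\<^sub>R (axis i 1 :: real ^ 'n)) = (\<chi> i. x i)" for x :: "'n \<Rightarrow> real"
    using basis_expansion[of "\<chi> i. x i"] by (simp add: scalar_mult_eq_scaleR)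
  ultimately show ?thesis
    unfolding eq vec_lambda_eta by simp
qed

lemma borel_measurable_kac_process_vec:
  assumes "kac_process_vec M a c K" and "0 \<le> t"
  shows "K t \<in> borel_measurable M"
  unfolding borel_measurable_euclidean_space[of "K t"]
  using assms by (auto simp: Basis_vec_def inner_axis kac_process_vec_def kac_process_def)

text \<open>Setting the process to 0 on a null set upgrades the almost sure path properties to all
  \<omega>. The modification agrees with \<open>X\<close> at all times \<open>t \<ge> 0\<close> off
  a single null set, so laws and almost sure path statements carry over.\<close>

lemma kac_process_vec_modification:
  fixes K X :: "real \<Rightarrow> 'w \<Rightarrow> real ^ 'n"
  assumes M: "prob_space M" and c: "0 \<le> c" and X0[measurable]: "X0 \<in> borel_measurable M"
    and K: "kac_process_vec M a c K" and X: "\<And>t \<omega>. X t \<omega> = X0 \<omega> + K t \<omega>"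
  obtains Y where "lipschitz_process M Y c" "AE \<omega> in M. \<forall>t\<ge>0. Y t \<omega> = X t \<omega>"
    "AE \<omega> in M. Y 0 \<omega> = X0 \<omega>"
proof -
  interpret prob_space M by (rule M)
  have Ki: "kac_process M a c (\<lambda>t \<omega>. K t \<omega> $ i)" for i
    using K by (simp add: kac_process_vec_def)
  have X_meas: "X t \<in> borel_measurable M" if "0 \<le> t" for t
    using borel_measurable_kac_process_vec[OF K that] by (simp add: X[abs_def])
  define good where "good \<omega> \<longleftrightarrow> (\<forall>i\<in>UNIV. K 0 \<omega> $ i = 0
    \<and> (\<forall>s\<ge>0. \<forall>t\<ge>0. \<bar>K t \<omega> $ i - K s \<omega> $ i\<bar> \<le> c * \<bar>t - s\<bar>)
    \<and> (\<forall>t\<ge>0. \<exists>D. ((\<lambda>s. K s \<omega> $ i) has_vector_derivative D) (at t within {t..})))" for \<omega>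
  have "AE \<omega> in M. good \<omega>"
    unfolding good_def by (intro AE_finite_allI kac_process_paths[OF M c Ki]) simp
  \<comment> \<open>\<open>good\<close> quantifies over uncountably many times, so measurability of
    its exceptional set is not evident; the measurable null superset \<open>N\<close> takes its
    place.\<close>
  then obtain N where N: "N \<in> null_sets M" and bad: "{\<omega>\<in>space M. \<not> good \<omega>} \<subseteq> N"
    unfolding eventually_ae_filter by blast
  have [measurable]: "N \<in> sets M" using N by auto
  have good: "K 0 \<omega> $ i = 0"
      "0 \<le> s \<Longrightarrow> 0 \<le> t \<Longrightarrow> \<bar>K t \<omega> $ i - K s \<omega> $ i\<bar> \<le> c * \<bar>t - s\<bar>"
      "0 \<le> t \<Longrightarrow> \<exists>D. ((\<lambda>s. K s \<omega> $ i) has_vector_derivative D) (at t within {t..})"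
    if "\<omega> \<in> space M" "\<omega> \<notin> N" for \<omega> i s t
    using bad that unfolding good_def by blast+
  \<comment> \<open>Freezing the path before time 0 keeps it Lipschitz and right differentiable on the whole real line.\<close>
  define Y where "Y t \<omega> = (if \<omega> \<in> N then 0 else X (max t 0) \<omega>)" for t \<omega>
  have "lipschitz_process M Y c"
  proof
    show "Y t \<in> borel_measurable M" for t
      unfolding Y_def[abs_def] using X_meas[of "max t 0"] by measurable
  next
    fix \<omega> s t and b :: "real ^ 'n" assume \<omega>: "\<omega> \<in> space M" and "b \<in> Basis"
    then obtain i where b: "b = axis i 1" by (auto simp: Basis_vec_def)
    show "\<bar>(Y t \<omega> - Y s \<omega>) \<bullet> b\<bar> \<le> c * \<bar>t - s\<bar>"
    proof (cases "\<omega> \<in> N")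
      case False
      have "\<bar>(Y t \<omega> - Y s \<omega>) \<bullet> b\<bar> = \<bar>K (max t 0) \<omega> $ i - K (max s 0) \<omega> $ i\<bar>"
        using False by (simp add: Y_def X b inner_axis)
      also have "\<dots> \<le> c * \<bar>max t 0 - max s 0\<bar>"
        by (rule good(2)) (use \<omega> False in auto)
      also have "\<dots> \<le> c * \<bar>t - s\<bar>"
        by (intro mult_left_mono c) auto
      finally show ?thesis .
    qed (use c in \<open>simp add: Y_def\<close>)
  next
    fix \<omega> and t :: real assume \<omega>: "\<omega> \<in> space M"
    consider "\<omega> \<in> N" | "\<omega> \<notin> N" "t < 0" | "\<omega> \<notin> N" "0 \<le> t" using not_le[of 0 t] by blast
    then show "\<exists>D. ((\<lambda>s. Y s \<omega>) has_vector_derivative D) (at t within {t..})"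
    proof cases
      case 1
      then show ?thesis by (intro exI[of _ 0]) (simp add: Y_def)
    next
      case 2
      have "((\<lambda>s. Y s \<omega>) has_vector_derivative 0) (at t within {t..})"
        \<comment> \<open>The radius \<open>- t\<close> keeps the comparison on negative times,
          where the path is constant.\<close>
        by (rule has_vector_derivative_transform_within[where f = "\<lambda>_. X 0 \<omega>" and d = "- t"])
           (use 2 in \<open>auto simp: Y_def dist_real_def max_def\<close>)
      then show ?thesis ..
    next
      case 3
      then have "\<forall>i. \<exists>D. ((\<lambda>s. K s \<omega> $ i) has_vector_derivative D) (at t within {t..})"
        using good(3)[OF \<omega>] by blast
      from choice[OF this] obtain D where
        "\<And>i. ((\<lambda>s. K s \<omega> $ i) has_vector_derivative D i) (at t within {t..})" by blast
      then have "((\<lambda>s. K s \<omega>) has_vector_derivative (\<chi> i. D i)) (at t within {t..})"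
        by (rule has_vector_derivative_vec)
      then have "((\<lambda>s. X0 \<omega> + K s \<omega>) has_vector_derivative 0 + (\<chi> i. D i)) (at t within {t..})"
        by (intro has_vector_derivative_add has_vector_derivative_const)
      then have "((\<lambda>s. Y s \<omega>) has_vector_derivative 0 + (\<chi> i. D i)) (at t within {t..})"
        by (rule has_vector_derivative_transform[rotated 2]) (use 3 in \<open>auto simp: Y_def X\<close>)
      then show ?thesis ..
    qed
  qed
  moreover have N_AE: "AE \<omega> in M. \<omega> \<notin> N" by (rule AE_not_in[OF N])
  then have "AE \<omega> in M. \<forall>t\<ge>0. Y t \<omega> = X t \<omega>"
    by eventually_elim (simp add: Y_def)
  moreover from N_AE have "AE \<omega> in M. Y 0 \<omega> = X0 \<omega>"
  proof (rule AE_mp, intro AE_I2 impI)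
    fix \<omega> assume "\<omega> \<in> space M" "\<omega> \<notin> N"
    then show "Y 0 \<omega> = X0 \<omega>" using good(1)[of \<omega>] by (simp add: Y_def X vec_eq_iff)
  qed
  ultimately show thesis by (rule that)
qed

theorem proposition5p6:
  fixes M :: "'w measure"
    and X0 :: "'w \<Rightarrow> real ^ 'n"
    and K X :: "real \<Rightarrow> 'w \<Rightarrow> real ^ 'n"
    and \<mu> :: "real \<Rightarrow> (real ^ 'n) measure"
    and a c :: real
  assumes "prob_space M"
    and "a > 0" and "c > 0"
    and "X0 \<in> borel_measurable M" and "distr M borel X0 \<in> P2"
    and "kac_process_vec M a c K"
    and "\<And>t \<omega>. X t \<omega> = X0 \<omega> + K t \<omega>"
    and "\<And>t. \<mu> t = distr M borel (X t)"
  shows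
    "((\<forall>t\<ge>0. \<mu> t \<in> P2) \<and>
      (\<forall>s\<ge>0. \<forall>t\<ge>0. W2 (\<mu> s) (\<mu> t) \<le> sqrt (real CARD('n)) * c * \<bar>s - t\<bar>) \<and>
      (AE \<omega> in M. (sqrt (real CARD('n)) * c)-lipschitz_on {0..} (\<lambda>t. X t \<omega>)))
     \<and>
     ((\<forall>T>0. AC2 {0..T} \<mu>) \<and>
      (\<exists>v. velocity_field {0<..} \<mu> v \<and>
           (AE t in lborel. 0 \<le> t \<longrightarrow>
              (\<integral>\<^sup>+ x. ennreal ((norm (v t x))\<^sup>2) \<partial>\<mu> t) \<le> ennreal (real CARD('n) * c\<^sup>2))))
     \<and>
     support_grows_at_most_linearly \<mu>"
proof -
  have c: "0 \<le> c" using \<open>c > 0\<close> by simp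
  obtain Y where Y: "lipschitz_process M Y c" and YX: "AE \<omega> in M. \<forall>t\<ge>0. Y t \<omega> = X t \<omega>"
    and Y0: "AE \<omega> in M. Y 0 \<omega> = X0 \<omega>"
    by (rule kac_process_vec_modification[OF assms(1) c assms(4,6,7)])
  interpret lipschitz_process M Y c by (rule Y)
  have X_meas: "X t \<in> borel_measurable M" if "0 \<le> t" for t
    using borel_measurable_kac_process_vec[OF assms(6) that] assms(4) by (simp add: assms(7)[abs_def])
  have \<mu>: "\<mu> t = distr M borel (Y t)" if "0 \<le> t" for t
    unfolding assms(8) using YX that X_meas[OF that] measurable_Y
    by (intro distr_cong_AE) auto
  \<comment> \<open>The second moment is assumed for \<open>X0\<close>; this is the time from which
    \<open>distr_in_P2\<close> carries it to all others.\<close>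
  have "distr M borel (Y 0) = distr M borel X0"
    using Y0 measurable_Y assms(4) by (intro distr_cong_AE) auto
  then have P2: "\<mu> t \<in> P2" if "0 \<le> t" for t
    using distr_in_P2[of 0 t] assms(5) \<mu>[OF that] by simp
  have W2: "W2 (\<mu> s) (\<mu> t) \<le> sqrt (real CARD('n)) * c * \<bar>s - t\<bar>" if "0 \<le> s" "0 \<le> t" for s t
    using W2_le[of s t] that by (simp add: \<mu>)
  have Lip: "AE \<omega> in M. (sqrt (real CARD('n)) * c)-lipschitz_on {0..} (\<lambda>t. X t \<omega>)"
    using YX AE_space
  proof eventually_elim
    case (elim \<omega>)
    have "norm (X s \<omega> - X t \<omega>) \<le> sqrt (real CARD('n)) * c * \<bar>s - t\<bar>" if "0 \<le> s" "0 \<le> t" for s t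
      using lipschitz[of \<omega> s t] elim that by simp
    then show ?case using c by (auto intro!: lipschitz_onI simp: dist_norm)
  qed
  have supp: "support_grows_at_most_linearly \<mu>"
    unfolding support_grows_at_most_linearly_def
  proof (intro exI conjI allI impI)
    fix t :: real assume "0 \<le> t"
    then show "supp (\<mu> t) \<subseteq> (\<Union>x\<in>supp (\<mu> 0). cball x (sqrt (real CARD('n)) * c * t))"
      using supp_subset[of t 0] by (simp add: \<mu>)
  qed (use c in simp)
  obtain v where v: "velocity_field {0<..} \<mu> v"
    and v_bound: "\<And>t x b. b \<in> Basis \<Longrightarrow> \<bar>v t x \<bullet> b\<bar> \<le> c"
    by (rule velocity_field_exists[of "{0<..}" \<mu>]) (simp_all add: \<mu>)
  have "(\<integral>\<^sup>+ x. ennreal ((norm (v t x))\<^sup>2) \<partial>\<mu> t) \<le> ennreal (real CARD('n) * c\<^sup>2)" if "0 \<le> t" for t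
  proof -
    interpret \<mu>t: prob_space "\<mu> t"
      using \<mu>[OF that] prob_space_distr[OF measurable_Y] by simp
    have "(\<integral>\<^sup>+ x. ennreal ((norm (v t x))\<^sup>2) \<partial>\<mu> t) \<le> (\<integral>\<^sup>+ x. ennreal (real CARD('n) * c\<^sup>2) \<partial>\<mu> t)"
      using norm_square_le_of_coords[OF v_bound] by (intro nn_integral_mono ennreal_leI) simp
    then show ?thesis by (simp add: \<mu>t.emeasure_space_1)
  qed
  then have "AE t in lborel. 0 \<le> t \<longrightarrow>
      (\<integral>\<^sup>+ x. ennreal ((norm (v t x))\<^sup>2) \<partial>\<mu> t) \<le> ennreal (real CARD('n) * c\<^sup>2)"
    by simp
  with P2 W2 Lip Lipschitz_curve_AC2[OF P2 W2] v supp show ?thesis by blast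
qed

end
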